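(* Let $\{Z_n\}_{n\ge0}$ be the one-dimensional ($d=1$) branching random walk described in the context, with offspring mean $m=1$ and offspring variance $\sigma^2<\infty$. Suppose that $\mathbb{E}[|X|^{\alpha}]<\infty$ for some $\alpha>2$. Then for every $r>0$, $$\lim_{n\to\infty}\mathbb{P}\left(\frac{R_n}{n}\ge r\right)=e^{-\frac{4r}{\sigma^2}}.$$
   Context: Let $\{p_k\}_{k\ge0}$ be an offspring distribution on $\{0,1,2,\dots\}$ with $p_0<1$, $p_1<1$, mean $m=\sum_k kp_k$ and variance $\sigma^2=\sum_k k^2p_k-m^2$. Let $X$ be an $\mathbb{R}^d$-valued random vector (the displacement) with mean zero whose components are i.i.d. The branching random walk $\{Z_n\}_{n\ge0}$ is a point-measure-valued process: $Z_0$ is a Poisson random measure on $\mathbb{R}^d$ with Lebesgue intensity (this law is denoted $\mathbb{P}$); at each generation every particle independently dies and is replaced by a random number of children with law $\{p_k\}$, and each child independently is displaced from its parent's position by an independent copy of $X$; $Z_n$ is the counting measure of particle positions at generation $n$. Let $B(u)=\{x\in\mathbb{R}^d:|x|<u\}$ and $R_n:=\sup\{u>0: Z_n(B(u))=0\}$ (with $\sup\emptyset=0$), the radius of the largest empty ball centered at the origin at time $n$. *)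

theory Defs
  imports "HOL-Probability.Probability"
begin

text \<open>Branching random walk in dimension 1, built on Ulam-Harris labels.
  Initial particles are enumerated as \<open>\<xi> i\<close> (i :: nat); the descendants of
  initial particle i are labelled by lists v :: nat list.  \<open>K i v\<close> is the
  number of children of the particle with label v in tree i, and \<open>D i v\<close> is the
  displacement of the particle v (v nonempty) relative to its parent.\<close>

definition gen_particles :: "(nat \<Rightarrow> nat list \<Rightarrow> 'a \<Rightarrow> nat) \<Rightarrow> nat \<Rightarrow> nat \<Rightarrow> 'a \<Rightarrow> nat list set" where
  "gen_particles K i n \<omega> = {v. length v = n \<and> (\<forall>j<n. v ! j < K i (take j v) \<omega>)}"

definition particle_pos :: "(nat \<Rightarrow> 'a \<Rightarrow> real) \<Rightarrow> (nat \<Rightarrow> nat list \<Rightarrow> 'a \<Rightarrow> real) \<Rightarrow> nat \<Rightarrow> nat list \<Rightarrow> 'a \<Rightarrow> real" where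
  "particle_pos \<xi> D i v \<omega> = \<xi> i \<omega> + (\<Sum>j<length v. D i (take (Suc j) v) \<omega>)"

definition brw_Z :: "(nat \<Rightarrow> 'a \<Rightarrow> real) \<Rightarrow> (nat \<Rightarrow> nat list \<Rightarrow> 'a \<Rightarrow> nat) \<Rightarrow> (nat \<Rightarrow> nat list \<Rightarrow> 'a \<Rightarrow> real)
    \<Rightarrow> nat \<Rightarrow> 'a \<Rightarrow> real set \<Rightarrow> ennreal" where
  "brw_Z \<xi> K D n \<omega> A = emeasure (count_space UNIV)
     {(i, v). v \<in> gen_particles K i n \<omega> \<and> particle_pos \<xi> D i v \<omega> \<in> A}"

definition brw_R :: "(nat \<Rightarrow> 'a \<Rightarrow> real) \<Rightarrow> (nat \<Rightarrow> nat list \<Rightarrow> 'a \<Rightarrow> nat) \<Rightarrow> (nat \<Rightarrow> nat list \<Rightarrow> 'a \<Rightarrow> real)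
    \<Rightarrow> nat \<Rightarrow> 'a \<Rightarrow> ereal" where
  "brw_R \<xi> K D n \<omega> = Sup (insert 0 (ereal ` {u. 0 < u \<and> brw_Z \<xi> K D n \<omega> (ball 0 u) = 0}))"

definition poisson_point_seq :: "'a measure \<Rightarrow> (nat \<Rightarrow> 'a \<Rightarrow> real) \<Rightarrow> bool" where
  "poisson_point_seq M \<xi> \<longleftrightarrow>
     (\<forall>i. \<xi> i \<in> borel_measurable M) \<and>
     (\<forall>A. A \<in> sets borel \<and> bounded A \<longrightarrow>
        (AE \<omega> in M. finite {i. \<xi> i \<omega> \<in> A}) \<and>
        distr M (count_space UNIV) (\<lambda>\<omega>. card {i. \<xi> i \<omega> \<in> A})
          = measure_pmf (poisson_pmf (measure lborel A))) \<and>
     (\<forall>(k::nat) (A :: nat \<Rightarrow> real set).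
        (\<forall>j<k. A j \<in> sets borel \<and> bounded (A j)) \<and> disjoint_family_on A {..<k} \<longrightarrow>
        prob_space.indep_vars M (\<lambda>_. count_space UNIV) (\<lambda>j \<omega>. card {i. \<xi> i \<omega> \<in> A j}) {..<k})"

end

theory Submission
  imports Defs "HOL-Real_Asymp.Real_Asymp"
begin

text \<open>Since the radius is at least \<open>r n\<close> iff no particle of generation \<open>n\<close> lies in the ball of
  radius \<open>r n\<close>, the claim is about an empty ball. By Kolmogorov's estimate a critical tree survives
  to generation \<open>n\<close> with probability \<open>\<sim> 2 / (\<sigma>\<^sup>2 n)\<close>. The expected number of particles
  of one tree in generation \<open>n\<close> displaced by more than \<open>\<epsilon> n\<close> equals the probability that a random
  walk is displaced that far, which is \<open>o(1/n)\<close> because more than two moments are finite. Hence up to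
  negligible events the ball of radius \<open>r n\<close> is empty iff all trees rooted within distance
  \<open>(r \<plusminus> \<epsilon>) n\<close> are extinct, and Poisson thinning gives this event probability
  \<open>exp (- 2 (r \<plusminus> \<epsilon>) n \<sqdot> 2 / (\<sigma>\<^sup>2 n))\<close> asymptotically.\<close>

subsection \<open>Extinction of critical branching processes\<close>

text \<open>About \<open>2 r n\<close> roots lie in the relevant window, so an error of
  \<open>o(1/n)\<close> per tree is affordable, while Chebyshev's inequality would give only
  \<open>O(1/n)\<close> for a displacement beyond \<open>\<epsilon> n\<close>. Steps are therefore
  truncated at a power of \<open>n\<close>, and the exponential moment of the truncated steps is
  used. The second obstacle is that there are infinitely many roots: a bound per tree cannot be
  summed over the roots outside the window. In the lower bound for the empty-ball probability,
  particles are therefore counted by where they land. By translation invariance of Lebesgue measure,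
  the expected number of far-displaced particles landing in \<open>(-a, a)\<close> is
  \<open>2 a\<close> times the expected number in one tree, wherever the roots are. In the upper
  bound only roots in the smaller window are inspected, and the displacement error enters the
  exponent of the thinning formula. No random walk is constructed: expectations over a tree are sums
  over Ulam-Harris labels of an occupation probability times a product over the steps, and
  criticality makes the occupation probabilities of each generation sum to 1.\<close>

text \<open>The quotient \<open>((1 - u)^k - 1 + k u) / u\<^sup>2\<close>, in a form that also makes sense at \<open>u = 0\<close>.\<close>

fun binom_remainder :: "nat \<Rightarrow> real \<Rightarrow> real" where
  "binom_remainder 0 u = 0"
| "binom_remainder (Suc k) u = (1 - u) * binom_remainder k u + real k"

lemma power_one_minus_eq_binom_remainder:
  "(1 - u) ^ k = 1 - real k * u + u\<^sup>2 * binom_remainder k u"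
proof (induction k)
  case (Suc k)
  show ?case by (simp add: Suc algebra_simps power2_eq_square)
qed simp

text \<open>The upper bound is the value at \<open>u = 0\<close>. It has finite expectation under a
  finite second moment and so serves as the dominating function when \<open>u\<close> tends to
  0.\<close>

lemma binom_remainder_bounds:
  assumes "0 \<le> u" "u \<le> 1"
  shows "0 \<le> binom_remainder k u" "binom_remainder k u \<le> real k * (real k - 1) / 2"
proof -
  show nonneg: "0 \<le> binom_remainder k u" for k
    using assms by (induction k) simp_all
  show "binom_remainder k u \<le> real k * (real k - 1) / 2"
  proof (induction k)
    case (Suc k)
    have "(1 - u) * binom_remainder k u \<le> 1 * binom_remainder k u"
      using assms nonneg[of k] by (intro mult_right_mono) auto
    with Suc show ?case by (simp add: field_simps)
  qed simp
qed

text \<open>This bound is uniform in \<open>u\<close>; it keeps \<open>pgf_remainder\<close> away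
  from 0 before anything is known about the size of \<open>u\<close>.\<close>

lemma binom_remainder_ge_1:
  assumes "0 \<le> u" "u \<le> 1" "2 \<le> k"
  shows "1 \<le> binom_remainder k u"
proof -
  obtain j where "k = Suc j" "1 \<le> j" using assms by (cases k) auto
  with binom_remainder_bounds(1)[OF assms(1,2), of j] assms show ?thesis
    by (simp add: add_increasing)
qed

lemma tendsto_binom_remainder:
  assumes "u \<longlonglongrightarrow> 0"
  shows "(\<lambda>n. binom_remainder k (u n)) \<longlonglongrightarrow> real k * (real k - 1) / 2"
proof (induction k)
  case (Suc k)
  have "(\<lambda>n. (1 - u n) * binom_remainder k (u n) + real k)
      \<longlonglongrightarrow> (1 - 0) * (real k * (real k - 1) / 2) + real k"
    by (intro tendsto_intros assms Suc)
  then show ?case by (simp add: field_simps)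
qed simp

text \<open>Cesaro averaging: the first \<open>N\<close> terms contribute a fixed amount
  \<open>C\<close>, which division by \<open>n\<close> makes negligible. It converts the limit of
  the increments of \<open>1 / u n\<close> into the linear growth rate of
  \<open>1 / u n\<close>.\<close>

lemma tendsto_arith_mean:
  fixes a :: "nat \<Rightarrow> real"
  assumes "a \<longlonglongrightarrow> L"
  shows "(\<lambda>n. (\<Sum>j<n. a j) / real n) \<longlonglongrightarrow> L"
proof (rule LIMSEQ_I)
  fix e :: real assume "e > 0"
  then obtain N where N: "\<And>n. n \<ge> N \<Longrightarrow> norm (a n - L) < e / 2"
    using LIMSEQ_D[OF assms, of "e/2"] by auto
  define C where "C = (\<Sum>j<N. \<bar>a j - L\<bar>)"
  have C0: "0 \<le> C" by (simp add: C_def sum_nonneg)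
  obtain N' :: nat where N': "2 * C / e < real N'" using reals_Archimedean2 by blast
  show "\<exists>no. \<forall>n\<ge>no. norm ((\<Sum>j<n. a j) / real n - L) < e"
  proof (intro exI allI impI)
    fix n assume n: "Suc (max N N') \<le> n"
    have "\<bar>\<Sum>j<n. a j - L\<bar> \<le> (\<Sum>j<n. \<bar>a j - L\<bar>)" by (rule sum_abs)
    also have "\<dots> = C + (\<Sum>j\<in>{N..<n}. \<bar>a j - L\<bar>)"
    proof -
      have "{..<n} = {..<N} \<union> {N..<n}" using n by auto
      then show ?thesis unfolding C_def by (simp add: sum.union_disjoint ivl_disj_int)
    qed
    also have "\<dots> \<le> C + (\<Sum>j\<in>{N..<n}. e / 2)"
      using N by (intro add_left_mono sum_mono) (auto simp: less_imp_le)
    also have "\<dots> \<le> C + real n * (e / 2)"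
      using \<open>e > 0\<close> by (auto intro!: mult_right_mono)
    also have "C < real n * (e / 2)"
    proof -
      have "2 * C / e < real n" using N' n by linarith
      then show ?thesis using \<open>e > 0\<close> by (simp add: field_simps)
    qed
    finally have "\<bar>\<Sum>j<n. a j - L\<bar> < real n * e" by (simp add: mult.commute)
    moreover have "(\<Sum>j<n. a j) / real n - L = (\<Sum>j<n. a j - L) / real n"
      using n by (simp add: sum_subtractf field_simps)
    ultimately show "norm ((\<Sum>j<n. a j) / real n - L) < e"
      using n by (simp add: abs_divide field_simps mult.commute)
  qed
qed

locale critical_offspring =
  fixes p :: "nat pmf"
  assumes pmf_1_less_1: "pmf p 1 < 1"
    and integrable_offspring: "integrable (measure_pmf p) real"
    and mean_offspring: "measure_pmf.expectation p real = 1"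
    and integrable_offspring_sq: "integrable (measure_pmf p) (\<lambda>k. (real k)\<^sup>2)"
begin

abbreviation offspring_var :: real where
  "offspring_var \<equiv> measure_pmf.variance p real"

text \<open>Since the mean is 1, the variance is the second factorial moment, which is twice
  \<open>pgf_remainder 0\<close>.\<close>

lemma offspring_var_eq: "offspring_var = measure_pmf.expectation p (\<lambda>k. real k * (real k - 1))"
proof -
  have "offspring_var = measure_pmf.expectation p (\<lambda>k. (real k)\<^sup>2) - 1"
    using integrable_offspring integrable_offspring_sq
    by (subst measure_pmf.variance_eq) (simp_all add: mean_offspring)
  also have "\<dots> = measure_pmf.expectation p (\<lambda>k. (real k)\<^sup>2 - real k)"
    using integrable_offspring integrable_offspring_sq
    by (subst Bochner_Integration.integral_diff) (simp_all add: mean_offspring)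
  finally show ?thesis by (simp add: power2_eq_square algebra_simps)
qed

text \<open>A law carried by \<open>{0, 1}\<close> has mean \<open>pmf p 1\<close>, which cannot be
  1. This is the source of all nondegeneracy: it yields the decay of the survival probability and
  the positivity of the variance.\<close>

lemma prob_ge_2_pos: "0 < measure_pmf.prob p {2..}"
proof (rule ccontr)
  assume "\<not> ?thesis"
  then have "measure_pmf.prob p {2..} = 0" using measure_nonneg[of p "{2..}"] by linarith
  then have "set_pmf p \<inter> {2..} = {}" by (simp add: measure_pmf_zero_iff)
  then have *: "set_pmf p \<subseteq> {..<2}" by auto
  have "1 = measure_pmf.expectation p real" by (simp add: mean_offspring)
  also have "\<dots> = (\<Sum>k<2. real k * pmf p k)"
    using * by (subst integral_measure_pmf[of "{..<2}"]) (auto simp: mult.commute)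
  also have "\<dots> = pmf p 1" by (simp add: numeral_2_eq_2)
  finally show False using pmf_1_less_1 by simp
qed

text \<open>With \<open>f\<close> the generating function of \<open>p\<close>, this is
  \<open>(f (1 - u) - (1 - u)) / u\<^sup>2\<close>, continued to \<open>u = 0\<close>.\<close>

definition pgf_remainder :: "real \<Rightarrow> real" where
  "pgf_remainder u = measure_pmf.expectation p (\<lambda>k. binom_remainder k u)"

lemma integrable_factorial_moment: "integrable (measure_pmf p) (\<lambda>k. real k * (real k - 1) / 2)"
proof -
  have "integrable (measure_pmf p) (\<lambda>k. ((real k)\<^sup>2 - real k) / 2)"
    using integrable_offspring integrable_offspring_sq by auto
  then show ?thesis by (simp add: power2_eq_square algebra_simps)
qed

lemma integrable_binom_remainder:
  assumes "0 \<le> u" "u \<le> 1"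
  shows "integrable (measure_pmf p) (\<lambda>k. binom_remainder k u)"
proof (rule Bochner_Integration.integrable_bound[OF integrable_factorial_moment])
  have "norm (binom_remainder k u) \<le> norm (real k * (real k - 1) / 2)" for k
    using binom_remainder_bounds[OF assms, of k] unfolding real_norm_def by linarith
  then show "AE k in measure_pmf p. norm (binom_remainder k u) \<le> norm (real k * (real k - 1) / 2)"
    by simp
qed simp

lemma pgf_eq_pgf_remainder:
  assumes "0 \<le> u" "u \<le> 1"
  shows "measure_pmf.expectation p (\<lambda>k. (1 - u) ^ k) = 1 - u + u\<^sup>2 * pgf_remainder u"
  unfolding power_one_minus_eq_binom_remainder pgf_remainder_def
  using integrable_offspring integrable_binom_remainder[OF assms] by (simp add: mean_offspring)

lemma pgf_remainder_ge:
  assumes "0 \<le> u" "u \<le> 1"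
  shows "measure_pmf.prob p {2..} \<le> pgf_remainder u"
proof -
  have "measure_pmf.prob p {2..} = measure_pmf.expectation p (indicator {2..})" by simp
  also have "\<dots> \<le> pgf_remainder u"
    unfolding pgf_remainder_def
    using binom_remainder_bounds(1)[OF assms] binom_remainder_ge_1[OF assms]
    by (intro integral_mono integrable_binom_remainder assms)
      (auto simp: indicator_def intro!: measure_pmf.integrable_const_bound[where B=1])
  finally show ?thesis .
qed

lemma tendsto_pgf_remainder:
  assumes "u \<longlonglongrightarrow> 0" "\<And>n. 0 \<le> u n" "\<And>n. u n \<le> 1"
  shows "(\<lambda>n. pgf_remainder (u n)) \<longlonglongrightarrow> offspring_var / 2"
proof -
  have "(\<lambda>n. measure_pmf.expectation p (\<lambda>k. binom_remainder k (u n)))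
      \<longlonglongrightarrow> measure_pmf.expectation p (\<lambda>k. real k * (real k - 1) / 2)"
    by (rule integral_dominated_convergence[OF _ _ integrable_factorial_moment])
      (auto intro!: tendsto_binom_remainder assms AE_I2
         simp: binom_remainder_bounds assms simp del: divide_le_eq_numeral1 le_divide_eq_numeral1)
  then show ?thesis by (simp add: pgf_remainder_def[abs_def] offspring_var_eq)
qed

text \<open>The recursion reads \<open>u (Suc n) = u n * (1 - u n * pgf_remainder (u n))\<close>, so
  \<open>1 / u n\<close> has increments close to \<open>pgf_remainder (u n)\<close>, whose limit is
  half the variance once \<open>u n\<close> tends to 0. That convergence must come first: the rough
  bound \<open>c\<close> on the increments already makes \<open>1 / u n\<close> grow at least
  linearly. Averaging the increments then gives the exact rate.\<close>

theorem kolmogorov_survival_asymptotics: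
  assumes u0: "u 0 = 1"
    and uSuc: "\<And>n. u (Suc n) = 1 - measure_pmf.expectation p (\<lambda>k. (1 - u n) ^ k)"
  shows "(\<lambda>n. real n * u n) \<longlonglongrightarrow> 2 / offspring_var"
proof -
  define c where "c = measure_pmf.prob p {2..}"
  have c: "0 < c" using prob_ge_2_pos by (simp add: c_def)
  have pos: "0 < u n \<and> u n \<le> 1" for n
  proof (induction n)
    case (Suc n)
    then have u: "0 \<le> u n" "u n \<le> 1" by auto
    have 1: "0 \<le> measure_pmf.expectation p (\<lambda>k. (1 - u n) ^ k)"
      using u by (intro Bochner_Integration.integral_nonneg) auto
    \<comment> \<open>Strict positivity of \<open>u (Suc n)\<close>, needed for taking reciprocals:
      with probability \<open>c\<close> there are at least two children, and then
      \<open>(1 - u n) ^ k \<le> 1 - u n\<close>.\<close>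
    have "measure_pmf.expectation p (\<lambda>k. (1 - u n) ^ k)
        \<le> measure_pmf.expectation p (\<lambda>k. 1 - u n * indicator {2..} k)"
    proof (rule integral_mono)
      show "integrable (measure_pmf p) (\<lambda>k. (1 - u n) ^ k)"
        using u by (intro measure_pmf.integrable_const_bound[where B=1]) (auto intro!: power_le_one)
      show "(1 - u n) ^ k \<le> 1 - u n * indicator {2..} k" for k
        using u power_decreasing[of 1 k "1 - u n"] by (cases "2 \<le> k") (auto intro!: power_le_one)
      show "integrable (measure_pmf p) (\<lambda>k. 1 - u n * indicator {2..} k)"
        using u by (intro measure_pmf.integrable_const_bound[where B=1]) (auto simp: indicator_def)
    qed
    also have "\<dots> = 1 - u n * c"
      by (subst Bochner_Integration.integral_diff)
        (auto simp: c_def intro!: integrable_mult_right measure_pmf.integrable_const_bound[where B=1])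
    finally have "u n * c \<le> u (Suc n)" by (simp add: uSuc)
    moreover have "0 < u n * c" using Suc c by simp
    ultimately show ?case using 1 by (auto simp: uSuc)
  qed (simp add: u0)
  have step: "u (Suc n) = u n * (1 - u n * pgf_remainder (u n))" for n
    using pos[of n] by (simp add: uSuc pgf_eq_pgf_remainder algebra_simps power2_eq_square)
  have factor_pos: "0 < 1 - u n * pgf_remainder (u n)" for n
    using pos[of n] pos[of "Suc n"] by (simp add: step zero_less_mult_iff)
  have inv_step: "1 / u (Suc n) - 1 / u n = pgf_remainder (u n) / (1 - u n * pgf_remainder (u n))" for n
    using pos[of n] factor_pos[of n] unfolding step by (simp add: field_simps)
  have c_le: "c \<le> pgf_remainder (u n)" for n
    unfolding c_def using pos[of n] by (intro pgf_remainder_ge) auto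
  have inc: "c \<le> 1 / u (Suc n) - 1 / u n" for n
  proof -
    have "pgf_remainder (u n) * (1 - u n * pgf_remainder (u n)) \<le> pgf_remainder (u n) * 1"
      using c c_le[of n] pos[of n] by (intro mult_left_mono) (auto intro!: mult_nonneg_nonneg)
    then have "pgf_remainder (u n) \<le> pgf_remainder (u n) / (1 - u n * pgf_remainder (u n))"
      using factor_pos[of n] by (simp add: pos_le_divide_eq)
    with c_le[of n] show ?thesis by (simp add: inv_step)
  qed
  have tele: "1 / u n = 1 + (\<Sum>j<n. 1 / u (Suc j) - 1 / u j)" for n
    by (subst sum_lessThan_telescope) (simp add: u0)
  have lower: "1 + c * real n \<le> 1 / u n" for n
    using sum_mono[of "{..<n}" "\<lambda>_. c", OF inc] by (subst tele) (simp add: mult.commute)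
  have u_le: "u n \<le> 1 / (1 + c * real n)" for n
  proof -
    have "0 < 1 + c * real n" using c by (simp add: add_pos_nonneg)
    with lower[of n] pos[of n] show ?thesis by (simp add: field_simps)
  qed
  have u_lim: "u \<longlonglongrightarrow> 0"
  proof (rule tendsto_sandwich[where f="\<lambda>_. 0" and h="\<lambda>n. 1 / (1 + c * real n)"])
    show "(\<lambda>n. 1 / (1 + c * real n)) \<longlonglongrightarrow> 0" using c by real_asymp
  qed (use pos u_le in \<open>auto simp: less_imp_le\<close>)
  have rem_lim: "(\<lambda>n. pgf_remainder (u n)) \<longlonglongrightarrow> offspring_var / 2"
    using pos by (intro tendsto_pgf_remainder u_lim) (auto simp: less_imp_le)
  \<comment> \<open>Passing to the limit in the uniform bound shows that the variance is positive,
    so the final inversion is legitimate.\<close>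
  have "c \<le> offspring_var / 2"
    by (rule LIMSEQ_le_const[OF rem_lim]) (use c_le in auto)
  then have var_pos: "0 < offspring_var" using c by linarith
  have "(\<lambda>n. pgf_remainder (u n) / (1 - u n * pgf_remainder (u n)))
      \<longlonglongrightarrow> (offspring_var / 2) / (1 - 0 * (offspring_var / 2))"
    by (intro tendsto_intros rem_lim u_lim) auto
  then have "(\<lambda>n. 1 / u (Suc n) - 1 / u n) \<longlonglongrightarrow> offspring_var / 2"
    by (simp add: inv_step)
  then have "(\<lambda>n. 1 / real n + (\<Sum>j<n. 1 / u (Suc j) - 1 / u j) / real n)
      \<longlonglongrightarrow> 0 + offspring_var / 2"
    by (intro tendsto_add tendsto_arith_mean lim_1_over_n)
  moreover have "1 / real n + (\<Sum>j<n. 1 / u (Suc j) - 1 / u j) / real n = inverse (real n * u n)" for n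
  proof -
    have "inverse (real n * u n) = 1 / u n / real n" by (simp add: field_simps)
    then show ?thesis by (simp add: tele[of n] add_divide_distrib)
  qed
  ultimately have "(\<lambda>n. inverse (real n * u n)) \<longlonglongrightarrow> offspring_var / 2" by simp
  then have "(\<lambda>n. inverse (inverse (real n * u n))) \<longlonglongrightarrow> inverse (offspring_var / 2)"
    using var_pos by (intro tendsto_inverse) auto
  then show ?thesis by simp
qed

end

subsection \<open>Large deviations of the displacement\<close>

text \<open>Only an upper bound on \<open>x\<close> is assumed, because the steps are truncated from
  above and may be arbitrarily negative.\<close>

lemma exp_le_quadratic:
  fixes x :: real
  assumes "x \<le> 1"
  shows "exp x \<le> 1 + x + x\<^sup>2"
proof (cases "0 \<le> x")
  case True
  then show ?thesis using assms by (rule exp_bound)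
next
  case False
  define y where "y = - x"
  have y: "0 < y" using False by (simp add: y_def)
  have "exp x * (1 + y) \<le> exp x * exp y"
    using exp_ge_add_one_self[of y] by (intro mult_left_mono) auto
  also have "\<dots> = 1" by (simp add: y_def flip: exp_add)
  \<comment> \<open>The product equals \<open>1 + y ^ 3\<close>.\<close>
  also have "1 \<le> (1 - y + y\<^sup>2) * (1 + y)"
    using y by (simp add: algebra_simps power2_eq_square)
  finally have "exp x \<le> 1 - y + y\<^sup>2" using y by (simp add: mult_le_cancel_right)
  then show ?thesis by (simp add: y_def)
qed

text \<open>Truncating only from above keeps the mean nonpositive, so no centring is needed.\<close>

lemma (in prob_space) nn_integral_exp_truncated_le:
  fixes g :: "'a \<Rightarrow> real"
  assumes g: "integrable M g" "expectation g = 0" "integrable M (\<lambda>x. (g x)\<^sup>2)" and b: "0 < b"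
  shows "(\<integral>\<^sup>+x. ennreal (exp (min (g x) b / b)) \<partial>M) \<le> ennreal (exp (expectation (\<lambda>x. (g x)\<^sup>2) / b\<^sup>2))"
proof -
  have [measurable]: "g \<in> borel_measurable M" using g(1) by auto
  define V where "V = expectation (\<lambda>x. (g x)\<^sup>2)"
  have intmin: "integrable M (\<lambda>x. min (g x) b)" using g by (intro integrable_min) auto
  have sq: "(min (g x) b)\<^sup>2 \<le> (g x)\<^sup>2" for x
    using b by (auto simp: min_def intro!: power_mono)
  have intsq: "integrable M (\<lambda>x. (min (g x) b)\<^sup>2)"
    by (rule Bochner_Integration.integrable_bound[OF g(3)]) (use sq in auto)
  have intexp: "integrable M (\<lambda>x. exp (min (g x) b / b))"
    using b by (intro integrable_const_bound[where B="exp 1"]) (auto simp: min_def divide_le_eq)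
  have "expectation (\<lambda>x. exp (min (g x) b / b))
      \<le> expectation (\<lambda>x. 1 + min (g x) b / b + (min (g x) b)\<^sup>2 / b\<^sup>2)"
  proof (rule integral_mono[OF intexp])
    show "integrable M (\<lambda>x. 1 + min (g x) b / b + (min (g x) b)\<^sup>2 / b\<^sup>2)"
      using intmin intsq by auto
    show "exp (min (g x) b / b) \<le> 1 + min (g x) b / b + (min (g x) b)\<^sup>2 / b\<^sup>2" for x
      using b by (intro order_trans[OF exp_le_quadratic]) (auto simp: divide_le_eq power_divide)
  qed
  also have "\<dots> = 1 + expectation (\<lambda>x. min (g x) b) / b + expectation (\<lambda>x. (min (g x) b)\<^sup>2) / b\<^sup>2"
    using intmin intsq by (simp add: prob_space)
  also have "\<dots> \<le> 1 + 0 + V / b\<^sup>2"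
  proof -
    have "expectation (\<lambda>x. min (g x) b) \<le> expectation g"
      using intmin g by (intro integral_mono) auto
    moreover have "expectation (\<lambda>x. (min (g x) b)\<^sup>2) \<le> V"
      unfolding V_def using intsq g sq by (intro integral_mono) auto
    ultimately show ?thesis using b g(2) by (intro add_mono divide_right_mono) (auto simp: divide_le_eq)
  qed
  also have "\<dots> \<le> exp (V / b\<^sup>2)" using exp_ge_add_one_self[of "V / b\<^sup>2"] by simp
  finally show ?thesis
    using intexp by (subst nn_integral_eq_integral) (auto simp: V_def intro!: ennreal_leI)
qed

lemma (in prob_space) prob_gt_le_powr_moment:
  fixes g :: "'a \<Rightarrow> real"
  assumes g: "g \<in> borel_measurable M" "integrable M (\<lambda>x. \<bar>g x\<bar> powr \<alpha>)" and b: "0 < b" and \<alpha>: "0 < \<alpha>"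
  shows "prob {x \<in> space M. g x > b} \<le> expectation (\<lambda>x. \<bar>g x\<bar> powr \<alpha>) / b powr \<alpha>"
proof -
  note [measurable] = g(1)
  have "prob {x \<in> space M. g x > b} \<le> prob {x \<in> space M. b powr \<alpha> \<le> \<bar>g x\<bar> powr \<alpha>}"
    using b \<alpha> by (intro finite_measure_mono) (auto intro!: powr_mono2)
  also have "\<dots> \<le> expectation (\<lambda>x. \<bar>g x\<bar> powr \<alpha>) / b powr \<alpha>"
    using b g(2) by (intro integral_Markov_inequality_measure[where A="space M"]) auto
  finally show ?thesis .
qed

locale displacement =
  fixes \<mu> :: "real measure" and \<alpha> :: real
  assumes prob_\<mu>: "prob_space \<mu>" and sets_\<mu>: "sets \<mu> = sets borel"
    and integrable_X: "integrable \<mu> (\<lambda>x. x)" and mean_X: "(\<integral>x. x \<partial>\<mu>) = 0"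
    and \<alpha>: "\<alpha> > 2" and X_mom: "integrable \<mu> (\<lambda>x. \<bar>x\<bar> powr \<alpha>)"
begin

sublocale \<mu>: prob_space \<mu> by (rule prob_\<mu>)

lemma measurable_\<mu>_eq [measurable_cong]: "sets \<mu> = sets borel"
  by (rule sets_\<mu>)

lemma integrable_X_sq: "integrable \<mu> (\<lambda>x. x\<^sup>2)"
proof (rule Bochner_Integration.integrable_bound)
  show "integrable \<mu> (\<lambda>x. 1 + \<bar>x\<bar> powr \<alpha>)" using X_mom by auto
  have "x\<^sup>2 \<le> 1 + \<bar>x\<bar> powr \<alpha>" for x :: real
  proof (cases "1 \<le> \<bar>x\<bar>")
    case True
    then have "\<bar>x\<bar> powr 2 \<le> \<bar>x\<bar> powr \<alpha>" using \<alpha> by (intro powr_mono) auto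
    then show ?thesis using True by simp
  next
    case False
    then have "\<bar>x\<bar>\<^sup>2 \<le> 1" by (intro power_le_one) auto
    then show ?thesis by (simp add: add_increasing2)
  qed
  then show "AE x in \<mu>. norm (x\<^sup>2) \<le> norm (1 + \<bar>x\<bar> powr \<alpha>)"
    by (auto intro: order_trans[OF _ abs_ge_self])
qed simp

text \<open>The truncation level \<open>b\<close> is a power of \<open>n\<close> with exponent \<open>\<beta> < 1\<close> and \<open>\<alpha> \<beta> > 2\<close>: the first
  term bounds the probability of a step above \<open>b\<close>, the second is the Chernoff bound with
  parameter \<open>1 / b\<close> for the truncated steps, and the factor 2 accounts for the two signs.\<close>

definition tail_bound :: "real \<Rightarrow> nat \<Rightarrow> real" where
  "tail_bound \<epsilon> n = (let b = real n powr (1 / 2 + 1 / \<alpha>) in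
     2 * (real n * ((\<integral>x. \<bar>x\<bar> powr \<alpha> \<partial>\<mu>) / b powr \<alpha>)
       + exp (- \<epsilon> * real n / b) * exp ((\<integral>x. x\<^sup>2 \<partial>\<mu>) / b\<^sup>2) ^ n))"

lemma tail_bound_nonneg: "0 \<le> tail_bound \<epsilon> n"
  by (auto simp: tail_bound_def Let_def intro!: add_nonneg_nonneg mult_nonneg_nonneg divide_nonneg_nonneg)

text \<open>The exponent \<open>1 / 2 + 1 / \<alpha>\<close> meets three demands, each by
  \<open>\<alpha> > 2\<close> or \<open>\<alpha> > 0\<close>:
  \<open>n\<^sup>2 / b powr \<alpha>\<close> is \<open>n powr (1 - \<alpha> / 2)\<close> and
  vanishes; \<open>n / b\<close> is a positive power of \<open>n\<close>, so the Chernoff factor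
  beats the prefactor \<open>n\<close>; and \<open>b\<^sup>2 \<ge> n\<close> keeps the
  \<open>n\<close>-th power of the exponential moment bounded by \<open>exp V\<close>.\<close>

lemma tendsto_tail_bound:
  assumes \<epsilon>: "0 < \<epsilon>"
  shows "(\<lambda>n. real n * tail_bound \<epsilon> n) \<longlonglongrightarrow> 0"
proof -
  define C where "C = (\<integral>x. \<bar>x\<bar> powr \<alpha> \<partial>\<mu>)"
  define V where "V = (\<integral>x. x\<^sup>2 \<partial>\<mu>)"
  define \<gamma> where "\<gamma> = 1 / 2 - 1 / \<alpha>"
  have \<gamma>: "0 < \<gamma>" using \<alpha> by (simp add: \<gamma>_def field_simps)
  have V: "0 \<le> V" by (simp add: V_def)
  have C: "0 \<le> C" by (simp add: C_def)
  have le: "real n * tail_bound \<epsilon> n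
      \<le> 2 * (C * real n powr (1 - \<alpha> / 2) + exp V * (real n * exp (- \<epsilon> * real n powr \<gamma>)))" if "1 \<le> n" for n
  proof -
    define b where "b = real n powr (1 / 2 + 1 / \<alpha>)"
    have n: "0 < real n" using that by simp
    have "(1 / 2 + 1 / \<alpha>) * \<alpha> = \<alpha> / 2 + 1" using \<alpha> by (simp add: distrib_right)
    then have b\<alpha>: "b powr \<alpha> = real n powr (\<alpha> / 2 + 1)"
      by (simp add: b_def powr_powr)
    have "real n * (real n * (C / b powr \<alpha>)) = C * (real n powr 2 / real n powr (\<alpha> / 2 + 1))"
      using n by (simp add: b\<alpha> power2_eq_square)
    also have "\<dots> = C * real n powr (1 - \<alpha> / 2)"
      unfolding powr_diff[symmetric] by (simp add: algebra_simps)
    finally have 1: "real n * (real n * (C / b powr \<alpha>)) = C * real n powr (1 - \<alpha> / 2)" .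
    have "real n / b = real n powr 1 / real n powr (1 / 2 + 1 / \<alpha>)" using n by (simp add: b_def)
    also have "\<dots> = real n powr \<gamma>"
      unfolding powr_diff[symmetric] by (simp add: \<gamma>_def algebra_simps)
    finally have 2: "real n / b = real n powr \<gamma>" .
    have "b\<^sup>2 = real n powr (1 + 2 / \<alpha>)" using n
      by (simp add: b_def powr_powr flip: powr_numeral)
    also have "\<dots> \<ge> real n powr 1" using that \<alpha> by (intro powr_mono) auto
    finally have "real n \<le> b\<^sup>2" using n by simp
    then have "real n * V / b\<^sup>2 \<le> V" using n V by (simp add: divide_le_eq mult.commute mult_left_mono)
    then have 3: "exp (V / b\<^sup>2) ^ n \<le> exp V" by (simp flip: exp_of_nat_mult)
    have "real n * tail_bound \<epsilon> n
        = 2 * (real n * (real n * (C / b powr \<alpha>)) + real n * exp (- \<epsilon> * (real n / b)) * exp (V / b\<^sup>2) ^ n)"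
      by (simp add: tail_bound_def Let_def C_def V_def b_def algebra_simps)
    also have "\<dots> \<le> 2 * (C * real n powr (1 - \<alpha> / 2) + real n * exp (- \<epsilon> * real n powr \<gamma>) * exp V)"
      unfolding 1 2 using 3 by (intro mult_left_mono add_left_mono) auto
    finally show ?thesis by (simp add: mult_ac)
  qed
  show ?thesis
  proof (rule tendsto_sandwich[where f="\<lambda>_. 0"])
    have "(\<lambda>n. real n powr (1 - \<alpha> / 2)) \<longlonglongrightarrow> 0" using \<alpha> by real_asymp
    moreover have "(\<lambda>n. real n * exp (- \<epsilon> * real n powr \<gamma>)) \<longlonglongrightarrow> 0" using \<epsilon> \<gamma> by real_asymp
    ultimately have "(\<lambda>n. 2 * (C * real n powr (1 - \<alpha> / 2) + exp V * (real n * exp (- \<epsilon> * real n powr \<gamma>))))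
        \<longlonglongrightarrow> 2 * (C * 0 + exp V * 0)"
      by (intro tendsto_intros)
    then show "(\<lambda>n. 2 * (C * real n powr (1 - \<alpha> / 2) + exp V * (real n * exp (- \<epsilon> * real n powr \<gamma>)))) \<longlonglongrightarrow> 0"
      by simp
    show "\<forall>\<^sub>F n in sequentially. real n * tail_bound \<epsilon> n
        \<le> 2 * (C * real n powr (1 - \<alpha> / 2) + exp V * (real n * exp (- \<epsilon> * real n powr \<gamma>)))"
      using le by (intro eventually_sequentiallyI[of 1])
  qed (auto intro!: always_eventually tail_bound_nonneg mult_nonneg_nonneg)
qed

end

subsection \<open>The law of a single tree\<close>

text \<open>A tree is a marking of the Ulam--Harris labels by pairs (number of children, displacement).\<close>

definition tree_gen :: "nat \<Rightarrow> (nat list \<Rightarrow> nat \<times> real) \<Rightarrow> nat list set" where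
  "tree_gen n x = {v. length v = n \<and> (\<forall>j<n. v ! j < fst (x (take j v)))}"

text \<open>The sum runs over the nonempty prefixes because the displacement stored at a label is
  the step from its parent to it.\<close>

definition tree_disp :: "nat list \<Rightarrow> (nat list \<Rightarrow> nat \<times> real) \<Rightarrow> real" where
  "tree_disp v x = (\<Sum>j<length v. snd (x (take (Suc j) v)))"

abbreviation mark_space :: "(nat \<times> real) measure" where
  "mark_space \<equiv> count_space UNIV \<Otimes>\<^sub>M borel"

abbreviation tree_space :: "(nat list \<Rightarrow> nat \<times> real) measure" where
  "tree_space \<equiv> PiM UNIV (\<lambda>_. mark_space)"

lemma tree_gen_0: "tree_gen 0 x = {[]}"
  by (auto simp: tree_gen_def)

lemma Cons_in_tree_gen_Suc:
  "j # v \<in> tree_gen (Suc n) x \<longleftrightarrow> j < fst (x []) \<and> v \<in> tree_gen n (\<lambda>w. x (j # w))"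
  by (auto simp: tree_gen_def less_Suc_eq_0_disj)

text \<open>Every nonempty label begins with a child of the root, so survival splits over the
  subtrees of these children. This is the combinatorial form of the generating function
  recursion.\<close>

lemma tree_gen_Suc_empty_iff:
  "tree_gen (Suc n) x = {} \<longleftrightarrow> (\<forall>j<fst (x []). tree_gen n (\<lambda>w. x (j # w)) = {})"
proof -
  have "v \<in> tree_gen (Suc n) x \<Longrightarrow> \<exists>j w. v = j # w" for v
    by (cases v) (auto simp: tree_gen_def)
  then show ?thesis by (metis Cons_in_tree_gen_Suc equals0I ex_in_conv)
qed

lemma measurable_in_tree_gen [measurable]:
  "Measurable.pred tree_space (\<lambda>x. v \<in> tree_gen n x)"
  unfolding tree_gen_def by measurable

lemma measurable_tree_disp [measurable]: "tree_disp v \<in> borel_measurable tree_space"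
  unfolding tree_disp_def[abs_def] by measurable

lemma measurable_tree_gen_empty [measurable]: "Measurable.pred tree_space (\<lambda>x. tree_gen n x = {})"
  unfolding set_eq_iff empty_iff by measurable

text \<open>Peeling off the first letter shows that the sum over words of length \<open>n\<close> is
  the \<open>n\<close>-th power of the sum over letters.\<close>

lemma nn_integral_prod_lists:
  fixes a :: "nat \<Rightarrow> ennreal"
  assumes "(\<Sum>k. a k) = 1"
  shows "(\<integral>\<^sup>+v. (\<Prod>j<n. a (v ! j)) \<partial>count_space {v. length v = n}) = 1"
proof (induction n)
  case 0
  have "{v :: nat list. length v = 0} = {[]}" by auto
  then show ?case by (simp add: nn_integral_count_space_finite)
next
  case (Suc n)
  have bij: "bij_betw (\<lambda>(k, v). k # v) (UNIV \<times> {v. length v = n}) {v :: nat list. length v = Suc n}"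
    by (rule bij_betwI[where g="\<lambda>v. (hd v, tl v)"]) (auto simp: length_Suc_conv)
  have "(\<integral>\<^sup>+v. (\<Prod>j<Suc n. a (v ! j)) \<partial>count_space {v. length v = Suc n})
      = (\<integral>\<^sup>+(k, v). a k * (\<Prod>j<n. a (v ! j)) \<partial>count_space (UNIV \<times> {v. length v = n}))"
    by (subst nn_integral_bij_count_space[OF bij, symmetric])
      (auto simp: prod.lessThan_Suc_shift intro!: nn_integral_cong simp del: prod.lessThan_Suc)
  also have "\<dots> = (\<integral>\<^sup>+k. \<integral>\<^sup>+v. a k * (\<Prod>j<n. a (v ! j)) \<partial>count_space {v. length v = n} \<partial>count_space UNIV)"
  proof -
    interpret sigma_finite_measure "count_space {v :: nat list. length v = n}"
      by (rule sigma_finite_measure_count_space_countable) simp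
    have *: "count_space (UNIV \<times> {v. length v = n}) = count_space (UNIV :: nat set) \<Otimes>\<^sub>M count_space {v :: nat list. length v = n}"
      by (rule pair_measure_countable[symmetric]) auto
    have "(\<lambda>(k, v). a k * (\<Prod>j<n. a (v ! j))) \<in> borel_measurable (count_space (UNIV :: nat set) \<Otimes>\<^sub>M count_space {v. length v = n})"
      unfolding *[symmetric] by simp
    from nn_integral_fst[OF this] show ?thesis by (simp add: *)
  qed
  also have "\<dots> = (\<integral>\<^sup>+k. a k \<partial>count_space UNIV)"
    by (simp add: nn_integral_cmult Suc)
  also have "\<dots> = 1" using assms by (simp add: nn_integral_count_space_nat)
  finally show ?case .
qed

section \<open>The product law of a tree and first moments along a path\<close>

locale branching_walk = critical_offspring p + displacement \<mu> \<alpha>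
  for p :: "nat pmf" and \<mu> :: "real measure" and \<alpha> :: real
begin

definition mark_law :: "(nat \<times> real) measure" where
  "mark_law = measure_pmf p \<Otimes>\<^sub>M \<mu>"

definition tree_law :: "(nat list \<Rightarrow> nat \<times> real) measure" where
  "tree_law = PiM UNIV (\<lambda>_. mark_law)"

lemma sets_mark_law [measurable_cong]: "sets mark_law = sets mark_space"
  unfolding mark_law_def by (intro sets_pair_measure_cong) (simp_all add: sets_\<mu>)

lemma sets_tree_law [measurable_cong]: "sets tree_law = sets tree_space"
  unfolding tree_law_def by (intro sets_PiM_cong sets_mark_law refl)

lemma space_tree_law [simp]: "space tree_law = UNIV"
  using sets_eq_imp_space_eq[OF sets_tree_law] by (simp add: space_PiM space_pair_measure)

sublocale mark: prob_space mark_law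
proof -
  interpret pair_prob_space "measure_pmf p" \<mu> ..
  show "prob_space mark_law" unfolding mark_law_def by (rule prob_space_axioms)
qed

sublocale tree: prob_space tree_law
  unfolding tree_law_def by (intro prob_space_PiM mark.prob_space_axioms)

lemma distr_tree_coordinate: "distr tree_law mark_law (\<lambda>x. x w) = mark_law"
  unfolding tree_law_def by (rule distr_PiM_component) (auto intro: mark.prob_space_axioms)

lemma indep_tree_coordinates: "tree.indep_vars (\<lambda>_. mark_law) (\<lambda>w x. x w) UNIV"
proof (subst tree.indep_vars_iff_distr_eq_PiM)
  show "(\<lambda>x. x w) \<in> tree_law \<rightarrow>\<^sub>M mark_law" for w :: "nat list"
    unfolding tree_law_def by measurable
  have "distr tree_law (PiM UNIV (\<lambda>_. mark_law)) (\<lambda>x. \<lambda>i\<in>UNIV. x i) = distr tree_law tree_law (\<lambda>x. x)"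
    by (rule distr_cong) (auto simp: tree_law_def)
  then show "distr tree_law (PiM UNIV (\<lambda>_. mark_law)) (\<lambda>x. \<lambda>i\<in>UNIV. x i)
      = PiM UNIV (\<lambda>i. distr tree_law mark_law (\<lambda>x. x i))"
    by (simp add: distr_tree_coordinate) (simp add: tree_law_def)
qed simp

text \<open>The prefixes of \<open>v\<close> have different lengths, hence are distinct labels with
  independent marks. Independence is indexed by labels, so the product is rewritten over the set
  \<open>J\<close> of prefixes, where \<open>length w\<close> recovers the position.\<close>

lemma nn_integral_prod_path:
  assumes "length v = n" and g: "\<And>j. j \<le> n \<Longrightarrow> g j \<in> borel_measurable mark_law"
  shows "(\<integral>\<^sup>+x. (\<Prod>j\<le>n. g j (x (take j v))) \<partial>tree_law) = (\<Prod>j\<le>n. \<integral>\<^sup>+y. g j y \<partial>mark_law)"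
proof -
  define J where "J = (\<lambda>j. take j v) ` {..n}"
  have inj: "inj_on (\<lambda>j. take j v) {..n}"
    using assms(1) by (intro inj_onI) (metis atMost_iff length_take min_absorb2)
  have len: "length (take j v) = j" if "j \<le> n" for j using that assms(1) by simp
  have "(\<integral>\<^sup>+x. (\<Prod>w\<in>J. g (length w) (x w)) \<partial>tree_law) = (\<Prod>w\<in>J. \<integral>\<^sup>+x. g (length w) (x w) \<partial>tree_law)"
  proof (rule tree.indep_vars_nn_integral)
    show "tree.indep_vars (\<lambda>_. borel) (\<lambda>w x. g (length w) (x w)) J"
      by (rule tree.indep_vars_compose2[OF tree.indep_vars_subset[OF indep_tree_coordinates]])
        (auto simp: J_def len intro!: g)
  qed (auto simp: J_def)
  also have "\<dots> = (\<Prod>w\<in>J. \<integral>\<^sup>+y. g (length w) y \<partial>mark_law)"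
  proof (rule prod.cong[OF refl])
    fix w assume "w \<in> J"
    then have "g (length w) \<in> borel_measurable mark_law" using assms(1) by (auto simp: J_def len intro!: g)
    then have "(\<integral>\<^sup>+y. g (length w) y \<partial>distr tree_law mark_law (\<lambda>x. x w)) = (\<integral>\<^sup>+x. g (length w) (x w) \<partial>tree_law)"
      by (intro nn_integral_distr) (auto simp: tree_law_def)
    then show "(\<integral>\<^sup>+x. g (length w) (x w) \<partial>tree_law) = (\<integral>\<^sup>+y. g (length w) y \<partial>mark_law)"
      by (simp add: distr_tree_coordinate)
  qed
  finally show ?thesis
    unfolding J_def prod.reindex[OF inj] using len by (simp del: length_take cong: prod.cong_simp)
qed

lemma nn_integral_mark_law_mult:
  assumes [measurable]: "f \<in> borel_measurable (count_space UNIV)" "h \<in> borel_measurable borel"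
  shows "(\<integral>\<^sup>+y. f (fst y) * h (snd y) \<partial>mark_law) = (\<integral>\<^sup>+k. f k \<partial>measure_pmf p) * (\<integral>\<^sup>+d. h d \<partial>\<mu>)"
proof -
  have "(\<integral>\<^sup>+y. f (fst y) * h (snd y) \<partial>mark_law) = (\<integral>\<^sup>+k. \<integral>\<^sup>+d. f k * h d \<partial>\<mu> \<partial>measure_pmf p)"
    unfolding mark_law_def by (subst \<mu>.nn_integral_fst[symmetric]) auto
  also have "\<dots> = (\<integral>\<^sup>+k. f k * (\<integral>\<^sup>+d. h d \<partial>\<mu>) \<partial>measure_pmf p)"
    by (intro nn_integral_cong nn_integral_cmult) measurable
  finally show ?thesis by (simp add: nn_integral_multc)
qed

text \<open>The probability that the label \<open>v\<close> is occupied: at each ancestor the number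
  of children must exceed the next letter.\<close>

definition label_weight :: "nat list \<Rightarrow> ennreal" where
  "label_weight v = (\<Prod>j<length v. emeasure (measure_pmf p) {k. v ! j < k})"

text \<open>By the tail-sum formula, summing over one letter gives the mean offspring number 1. Thus
  each generation of a tree has expected size 1.\<close>

lemma sum_label_weight: "(\<integral>\<^sup>+v. label_weight v \<partial>count_space {v. length v = n}) = 1"
proof -
  have "(\<Sum>t. emeasure (measure_pmf p) {k. t < k}) = (\<integral>\<^sup>+k. of_nat k \<partial>measure_pmf p)"
    using nn_integral_nat_function[of "\<lambda>k. k" "measure_pmf p"] by simp
  also have "\<dots> = (\<integral>\<^sup>+k. ennreal (real k) \<partial>measure_pmf p)" by (simp add: ennreal_of_nat_eq_real_of_nat)
  also have "\<dots> = 1"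
    using integrable_offspring by (subst nn_integral_eq_integral) (auto simp: mean_offspring)
  finally have "(\<integral>\<^sup>+v. (\<Prod>j<n. emeasure (measure_pmf p) {k. v ! j < k}) \<partial>count_space {v. length v = n}) = 1"
    by (rule nn_integral_prod_lists)
  moreover have "(\<integral>\<^sup>+v. label_weight v \<partial>count_space {v. length v = n})
      = (\<integral>\<^sup>+v. (\<Prod>j<n. emeasure (measure_pmf p) {k. v ! j < k}) \<partial>count_space {v. length v = n})"
    by (rule nn_integral_cong) (simp add: label_weight_def)
  ultimately show ?thesis by simp
qed

text \<open>The many-to-one formula for one label: occupation depends on child counts, the product
  on displacements, and both components are independent within a mark and across marks.\<close>

lemma nn_integral_path_prod:
  assumes v: "length v = n" and h: "\<And>j. j < n \<Longrightarrow> h j \<in> borel_measurable borel"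
  shows "(\<integral>\<^sup>+x. indicator {x. v \<in> tree_gen n x} x * (\<Prod>j<n. h j (snd (x (take (Suc j) v)))) \<partial>tree_law)
    = label_weight v * (\<Prod>j<n. \<integral>\<^sup>+d. h j d \<partial>\<mu>)"
proof -
  \<comment> \<open>Child counts are tested at prefixes of length \<open>0\<close> to
    \<open>n - 1\<close>, displacements at lengths \<open>1\<close> to \<open>n\<close>. Padding
    with 1 at \<open>j = n\<close> here, and at \<open>j = 0\<close> for \<open>h'\<close>, puts
    both on the common range \<open>{..n}\<close>.\<close>
  define f where "f j k = (if j < n then indicator {k. v ! j < k} k else 1 :: ennreal)" for j k
  define h' where "h' j d = (case j of 0 \<Rightarrow> 1 | Suc i \<Rightarrow> h i d)" for j and d :: real
  have h'[measurable]: "h' j \<in> borel_measurable borel" if "j \<le> n" for j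
    using that h by (cases j) (auto simp: h'_def[abs_def])
  have "(\<integral>\<^sup>+x. indicator {x. v \<in> tree_gen n x} x * (\<Prod>j<n. h j (snd (x (take (Suc j) v)))) \<partial>tree_law)
      = (\<integral>\<^sup>+x. (\<Prod>j\<le>n. f j (fst (x (take j v))) * h' j (snd (x (take j v)))) \<partial>tree_law)"
  proof (rule nn_integral_cong)
    fix x :: "nat list \<Rightarrow> nat \<times> real"
    have "(\<Prod>j\<le>n. f j (fst (x (take j v)))) = (\<Prod>j<n. f j (fst (x (take j v))))"
      by (simp add: f_def flip: lessThan_Suc_atMost)
    also have "\<dots> = indicator {x. v \<in> tree_gen n x} x"
      using v by (auto simp: f_def tree_gen_def indicator_def prod_zero_iff intro!: prod.neutral)
    finally have 1: "(\<Prod>j\<le>n. f j (fst (x (take j v)))) = indicator {x. v \<in> tree_gen n x} x" .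
    have 2: "(\<Prod>j\<le>n. h' j (snd (x (take j v)))) = (\<Prod>j<n. h j (snd (x (take (Suc j) v))))"
      by (simp add: h'_def prod.lessThan_Suc_shift del: prod.lessThan_Suc flip: lessThan_Suc_atMost)
    show "indicator {x. v \<in> tree_gen n x} x * (\<Prod>j<n. h j (snd (x (take (Suc j) v))))
       = (\<Prod>j\<le>n. f j (fst (x (take j v))) * h' j (snd (x (take j v))))"
      by (simp add: prod.distrib 1 2)
  qed
  also have "\<dots> = (\<Prod>j\<le>n. \<integral>\<^sup>+y. f j (fst y) * h' j (snd y) \<partial>mark_law)"
    using v by (intro nn_integral_prod_path) auto
  also have "\<dots> = (\<Prod>j\<le>n. (\<integral>\<^sup>+k. f j k \<partial>measure_pmf p) * (\<integral>\<^sup>+d. h' j d \<partial>\<mu>))"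
    by (intro prod.cong refl nn_integral_mark_law_mult) auto
  also have "\<dots> = (\<Prod>j\<le>n. \<integral>\<^sup>+k. f j k \<partial>measure_pmf p) * (\<Prod>j\<le>n. \<integral>\<^sup>+d. h' j d \<partial>\<mu>)"
    by (rule prod.distrib)
  also have "(\<Prod>j\<le>n. \<integral>\<^sup>+k. f j k \<partial>measure_pmf p) = label_weight v"
    using v by (simp add: f_def label_weight_def flip: lessThan_Suc_atMost)
  also have "(\<Prod>j\<le>n. \<integral>\<^sup>+d. h' j d \<partial>\<mu>) = (\<Prod>j<n. \<integral>\<^sup>+d. h j d \<partial>\<mu>)"
    by (simp add: h'_def prod.lessThan_Suc_shift \<mu>.emeasure_space_1 del: prod.lessThan_Suc flip: lessThan_Suc_atMost)
  finally show ?thesis .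
qed

text \<open>Either one step exceeds \<open>b\<close>, or truncation at \<open>b\<close> changes
  nothing and the exponential Markov inequality applies. The indicator is dominated pointwise by a
  sum of products over steps, so that \<open>nn_integral_path_prod\<close> evaluates each term. The
  sign \<open>s\<close> selects one of the two tails.\<close>

lemma path_tail_le:
  assumes v: "length v = n" and n: "1 \<le> n" and s: "s \<in> {1, -1}"
  shows "emeasure tree_law {x. v \<in> tree_gen n x \<and> s * tree_disp v x > \<epsilon> * real n}
    \<le> label_weight v * ennreal (tail_bound \<epsilon> n / 2)"
proof -
  define b where "b = real n powr (1 / 2 + 1 / \<alpha>)"
  have b: "0 < b" using n by (simp add: b_def)
  define C where "C = (\<integral>x. \<bar>x\<bar> powr \<alpha> \<partial>\<mu>)"
  define V where "V = (\<integral>x. x\<^sup>2 \<partial>\<mu>)"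
  have C: "0 \<le> C" by (simp add: C_def)
  define I :: "(nat list \<Rightarrow> nat \<times> real) \<Rightarrow> ennreal" where "I = indicator {x. v \<in> tree_gen n x}"
  have I [measurable]: "I \<in> borel_measurable tree_law" unfolding I_def by measurable
  \<comment> \<open>For fixed \<open>i\<close> the product over \<open>j\<close> demands a large
    step at position \<open>i\<close> only.\<close>
  define jump where "jump i j d = (if j = i then indicator {d. s * d > b} d else 1 :: ennreal)" for i j :: nat and d
  have [measurable]: "jump i j \<in> borel_measurable borel" for i j unfolding jump_def by measurable
  \<comment> \<open>Exponential weight of a truncated step with parameter \<open>1 / b\<close>;
    \<open>c\<close> below is the matching factor for the threshold
    \<open>\<epsilon> n\<close>.\<close>
  define w where "w d = ennreal (exp (min (s * d) b / b))" for d
  have [measurable]: "w \<in> borel_measurable borel" unfolding w_def by measurable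
  define c where "c = ennreal (exp (- \<epsilon> * real n / b))"
  have pw: "indicator {x. v \<in> tree_gen n x \<and> s * tree_disp v x > \<epsilon> * real n} x
      \<le> (\<Sum>i<n. I x * (\<Prod>j<n. jump i j (snd (x (take (Suc j) v)))))
        + c * (I x * (\<Prod>j<n. w (snd (x (take (Suc j) v)))))" for x
  proof (cases "v \<in> tree_gen n x \<and> s * tree_disp v x > \<epsilon> * real n")
    case True
    then have I1: "I x = 1" by (simp add: I_def)
    show ?thesis
    proof (cases "\<exists>i<n. s * snd (x (take (Suc i) v)) > b")
      case True
      then obtain i where i: "i < n" "s * snd (x (take (Suc i) v)) > b" by blast
      then have "1 = I x * (\<Prod>j<n. jump i j (snd (x (take (Suc j) v))))"
        by (simp add: I1 jump_def)
      also have "\<dots> \<le> (\<Sum>i<n. I x * (\<Prod>j<n. jump i j (snd (x (take (Suc j) v)))))"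
        using i by (intro member_le_sum) auto
      finally show ?thesis by (auto simp: indicator_def intro: add_increasing2)
    next
      \<comment> \<open>No step exceeds \<open>b\<close>, so the truncated steps have the same sum,
        which is above \<open>\<epsilon> n\<close>, and the exponential term alone is at least
        1.\<close>
      case False
      then have le_b: "s * snd (x (take (Suc j) v)) \<le> b" if "j < n" for j
        using that by (meson not_less)
      then have "(\<Sum>j<n. min (s * snd (x (take (Suc j) v))) b) = (\<Sum>j<n. s * snd (x (take (Suc j) v)))"
        by (intro sum.cong refl min_absorb1) simp
      then have "\<epsilon> * real n \<le> (\<Sum>j<n. min (s * snd (x (take (Suc j) v))) b)"
        using \<open>v \<in> tree_gen n x \<and> s * tree_disp v x > \<epsilon> * real n\<close> v by (simp add: tree_disp_def sum_distrib_left)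
      then have "0 \<le> - \<epsilon> * real n / b + (\<Sum>j<n. min (s * snd (x (take (Suc j) v))) b / b)"
        using b by (simp add: divide_right_mono flip: sum_divide_distrib)
      then have "1 \<le> exp (- \<epsilon> * real n / b + (\<Sum>j<n. min (s * snd (x (take (Suc j) v))) b / b))"
        by simp
      moreover have "c * (I x * (\<Prod>j<n. w (snd (x (take (Suc j) v)))))
          = ennreal (exp (- \<epsilon> * real n / b + (\<Sum>j<n. min (s * snd (x (take (Suc j) v))) b / b)))"
        by (simp only: c_def w_def I1 prod_ennreal exp_add exp_sum ennreal_mult prod_nonneg exp_ge_zero
            finite_lessThan mult_1_left)
      ultimately have "1 \<le> c * (I x * (\<Prod>j<n. w (snd (x (take (Suc j) v)))))"
        by simp
      then show ?thesis by (auto simp: indicator_def intro: add_increasing)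
    qed
  qed simp
  have [measurable]: "(\<lambda>x. x w) \<in> tree_law \<rightarrow>\<^sub>M mark_space" for w :: "nat list" by measurable
  have "{x. v \<in> tree_gen n x \<and> s * tree_disp v x > \<epsilon> * real n}
      = {x \<in> space tree_law. v \<in> tree_gen n x \<and> s * tree_disp v x > \<epsilon> * real n}" by simp
  also have "\<dots> \<in> sets tree_law" by measurable
  finally have ms: "{x. v \<in> tree_gen n x \<and> s * tree_disp v x > \<epsilon> * real n} \<in> sets tree_law" .
  have "emeasure tree_law {x. v \<in> tree_gen n x \<and> s * tree_disp v x > \<epsilon> * real n}
      = (\<integral>\<^sup>+x. indicator {x. v \<in> tree_gen n x \<and> s * tree_disp v x > \<epsilon> * real n} x \<partial>tree_law)"
    using ms by simp
  also have "\<dots> \<le> (\<integral>\<^sup>+x. (\<Sum>i<n. I x * (\<Prod>j<n. jump i j (snd (x (take (Suc j) v)))))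
        + c * (I x * (\<Prod>j<n. w (snd (x (take (Suc j) v))))) \<partial>tree_law)"
    by (intro nn_integral_mono pw)
  also have "\<dots> = (\<Sum>i<n. \<integral>\<^sup>+x. I x * (\<Prod>j<n. jump i j (snd (x (take (Suc j) v)))) \<partial>tree_law)
        + c * (\<integral>\<^sup>+x. I x * (\<Prod>j<n. w (snd (x (take (Suc j) v)))) \<partial>tree_law)"
    by (subst nn_integral_add) (auto simp: nn_integral_sum nn_integral_cmult)
  also have "\<dots> = (\<Sum>i<n. label_weight v * emeasure \<mu> {d. s * d > b})
        + c * (label_weight v * (\<integral>\<^sup>+d. w d \<partial>\<mu>) ^ n)"
  proof -
    have "(\<Prod>j<n. \<integral>\<^sup>+d. jump i j d \<partial>\<mu>) = emeasure \<mu> {d. s * d > b}" if "i < n" for i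
    proof -
      have "(\<integral>\<^sup>+d. jump i j d \<partial>\<mu>) = (if j = i then emeasure \<mu> {d. s * d > b} else 1)" for j
        by (simp add: jump_def \<mu>.emeasure_space_1)
      then show ?thesis using that by simp
    qed
    then have "(\<integral>\<^sup>+x. I x * (\<Prod>j<n. jump i j (snd (x (take (Suc j) v)))) \<partial>tree_law)
        = label_weight v * emeasure \<mu> {d. s * d > b}" if "i < n" for i
      unfolding I_def using that by (subst nn_integral_path_prod[OF v]) auto
    moreover have "(\<integral>\<^sup>+x. I x * (\<Prod>j<n. w (snd (x (take (Suc j) v)))) \<partial>tree_law)
        = label_weight v * (\<integral>\<^sup>+d. w d \<partial>\<mu>) ^ n"
      unfolding I_def by (subst nn_integral_path_prod[OF v, of "\<lambda>_. w"]) auto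
    ultimately show ?thesis by simp
  qed
  also have "\<dots> = label_weight v * (ennreal (real n) * emeasure \<mu> {d. s * d > b} + c * (\<integral>\<^sup>+d. w d \<partial>\<mu>) ^ n)"
    by (simp add: algebra_simps ennreal_of_nat_eq_real_of_nat)
  also have "\<dots> \<le> label_weight v * (ennreal (real n) * ennreal (C / b powr \<alpha>) + c * ennreal (exp (V / b\<^sup>2)) ^ n)"
  proof (intro mult_left_mono add_mono power_mono)
    have abs_s: "\<bar>s * d\<bar> = \<bar>d\<bar>" "(s * d)\<^sup>2 = d\<^sup>2" for d using s by auto
    have sp: "{d. s * d > b} = {d \<in> space \<mu>. s * d > b}"
      using sets_eq_imp_space_eq[OF sets_\<mu>] by simp
    show "emeasure \<mu> {d. s * d > b} \<le> ennreal (C / b powr \<alpha>)"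
      unfolding \<mu>.emeasure_eq_measure sp using \<mu>.prob_gt_le_powr_moment[of "\<lambda>d. s * d" \<alpha> b] X_mom b \<alpha>
      by (intro ennreal_leI) (simp add: abs_s C_def)
    show "(\<integral>\<^sup>+d. w d \<partial>\<mu>) \<le> ennreal (exp (V / b\<^sup>2))"
      unfolding w_def V_def using \<mu>.nn_integral_exp_truncated_le[of "\<lambda>d. s * d" b]
        integrable_X integrable_X_sq mean_X b by (simp add: abs_s)
  qed auto
  also have "ennreal (real n) * ennreal (C / b powr \<alpha>) + c * ennreal (exp (V / b\<^sup>2)) ^ n
      = ennreal (real n * (C / b powr \<alpha>) + exp (- \<epsilon> * real n / b) * exp (V / b\<^sup>2) ^ n)"
    using C by (simp add: c_def ennreal_power flip: ennreal_mult ennreal_plus)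
  also have "real n * (C / b powr \<alpha>) + exp (- \<epsilon> * real n / b) * exp (V / b\<^sup>2) ^ n = tail_bound \<epsilon> n / 2"
    by (simp add: tail_bound_def Let_def C_def V_def b_def)
  finally show ?thesis .
qed

text \<open>The left side is the expected number of far-displaced particles in generation
  \<open>n\<close>. The two signs contribute half of \<open>tail_bound\<close> each, and
  \<open>sum_label_weight\<close> leaves no factor from the branching.\<close>

lemma sum_path_tail_le:
  assumes n: "1 \<le> n"
  shows "(\<integral>\<^sup>+v. emeasure tree_law {x. v \<in> tree_gen n x \<and> \<bar>tree_disp v x\<bar> > \<epsilon> * real n}
      \<partial>count_space {v. length v = n}) \<le> ennreal (tail_bound \<epsilon> n)"
proof -
  define E where "E s v = {x. v \<in> tree_gen n x \<and> s * tree_disp v x > \<epsilon> * real n}" for s :: real and v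
  have ms: "E s v \<in> sets tree_law" for s v
  proof -
    have "E s v = {x \<in> space tree_law. v \<in> tree_gen n x \<and> s * tree_disp v x > \<epsilon> * real n}"
      by (simp add: E_def)
    also have "\<dots> \<in> sets tree_law" by measurable
    finally show ?thesis .
  qed
  have "emeasure tree_law {x. v \<in> tree_gen n x \<and> \<bar>tree_disp v x\<bar> > \<epsilon> * real n}
      \<le> label_weight v * ennreal (tail_bound \<epsilon> n)" if "length v = n" for v
  proof -
    have "{x. v \<in> tree_gen n x \<and> \<bar>tree_disp v x\<bar> > \<epsilon> * real n} = E 1 v \<union> E (-1) v"
      by (auto simp: E_def)
    then have "emeasure tree_law {x. v \<in> tree_gen n x \<and> \<bar>tree_disp v x\<bar> > \<epsilon> * real n}
        \<le> emeasure tree_law (E 1 v) + emeasure tree_law (E (-1) v)"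
      using ms by (auto intro: emeasure_subadditive)
    also have "\<dots> \<le> label_weight v * ennreal (tail_bound \<epsilon> n / 2) + label_weight v * ennreal (tail_bound \<epsilon> n / 2)"
      unfolding E_def using that n by (intro add_mono path_tail_le) auto
    also have "\<dots> = label_weight v * (ennreal (tail_bound \<epsilon> n / 2) + ennreal (tail_bound \<epsilon> n / 2))"
      by (simp add: distrib_left)
    also have "\<dots> = label_weight v * ennreal (tail_bound \<epsilon> n)"
      using tail_bound_nonneg[of \<epsilon> n] by (simp flip: ennreal_plus)
    finally show ?thesis .
  qed
  then have "(\<integral>\<^sup>+v. emeasure tree_law {x. v \<in> tree_gen n x \<and> \<bar>tree_disp v x\<bar> > \<epsilon> * real n}
      \<partial>count_space {v. length v = n})
      \<le> (\<integral>\<^sup>+v. label_weight v * ennreal (tail_bound \<epsilon> n) \<partial>count_space {v. length v = n})"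
    by (intro nn_integral_mono) auto
  also have "\<dots> = ennreal (tail_bound \<epsilon> n)"
    by (simp add: nn_integral_multc sum_label_weight)
  finally show ?thesis .
qed

end

lemma emeasure_UN_countable_le:
  assumes ms: "\<And>i. i \<in> I \<Longrightarrow> X i \<in> sets M" and I: "countable I"
  shows "emeasure M (\<Union>i\<in>I. X i) \<le> (\<integral>\<^sup>+i. emeasure M (X i) \<partial>count_space I)"
proof -
  have "emeasure M (\<Union>i\<in>I. X i) = (\<integral>\<^sup>+x. indicator (\<Union>i\<in>I. X i) x \<partial>M)"
    using ms I by (intro nn_integral_indicator[symmetric] sets.countable_UN'')
  also have "\<dots> \<le> (\<integral>\<^sup>+x. \<integral>\<^sup>+i. indicator (X i) x \<partial>count_space I \<partial>M)"
  proof (rule nn_integral_mono)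
    fix x
    show "indicator (\<Union>i\<in>I. X i) x \<le> (\<integral>\<^sup>+i. indicator (X i) x \<partial>count_space I :: ennreal)"
    proof (cases "\<exists>i\<in>I. x \<in> X i")
      case True
      then obtain i where "i \<in> I" "x \<in> X i" by blast
      then show ?thesis
        using nn_integral_ge_point[of i I "\<lambda>i. indicator (X i) x"] by (auto simp: indicator_def)
    qed simp
  qed
  also have "\<dots> = (\<integral>\<^sup>+i. \<integral>\<^sup>+x. indicator (X i) x \<partial>M \<partial>count_space I)"
    using ms I by (intro nn_integral_count_space_nn_integral) auto
  also have "\<dots> = (\<integral>\<^sup>+i. emeasure M (X i) \<partial>count_space I)"
    using ms by (intro nn_integral_cong) auto
  finally show ?thesis .
qed

section \<open>Extinction probabilities of a random tree\<close>

context branching_walk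
begin

text \<open>Prefixing labels with \<open>j\<close> is injective, and an injective reindexing of
  i.i.d. coordinates preserves the product law.\<close>

lemma distr_subtree: "distr tree_law tree_law (\<lambda>x w. x (j # w)) = tree_law"
proof -
  have "distr tree_law (PiM UNIV (\<lambda>_. mark_law)) (\<lambda>x. \<lambda>w\<in>UNIV. x (j # w)) = PiM UNIV (\<lambda>_. mark_law)"
    unfolding tree_law_def
    using distr_PiM_reindex[of UNIV "\<lambda>_. mark_law" "Cons j" UNIV] mark.prob_space_axioms by simp
  then show ?thesis by (simp add: tree_law_def restrict_UNIV)
qed

definition extinct_prob :: "nat \<Rightarrow> real" where
  "extinct_prob n = measure tree_law {x. tree_gen n x = {}}"

lemma extinct_prob_0: "extinct_prob 0 = 0"
  by (simp add: extinct_prob_def tree_gen_0)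

text \<open>The root's child count and the subtrees of the different children use disjoint sets of
  labels, hence are independent, and each subtree is distributed like the whole tree. Splitting over
  the value of the child count replaces conditioning.\<close>

lemma extinct_prob_Suc:
  "extinct_prob (Suc n) = measure_pmf.expectation p (\<lambda>k. extinct_prob n ^ k)"
proof -
  define q where "q = extinct_prob n"
  have q: "0 \<le> q" "q \<le> 1" by (auto simp: q_def extinct_prob_def)
  \<comment> \<open>One family for both kinds of variables: \<open>None\<close> is the child count
    of the root, \<open>Some i\<close> the extinction indicator of subtree \<open>i\<close>. Both
    take values in \<open>nat\<close>, so one independence statement covers them; \<open>blk\<close>
    lists the labels each depends on.\<close>
  define X where "X j x = (case j of None \<Rightarrow> fst (x [])
      | Some i \<Rightarrow> if tree_gen n (\<lambda>w. x (i # w)) = {} then 1 else 0)" for j and x :: "nat list \<Rightarrow> nat \<times> real"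
  define blk where "blk j = (case j of None \<Rightarrow> {[]} | Some i \<Rightarrow> range (Cons i))" for j :: "nat option"
  have "tree.indep_vars (\<lambda>j. PiM (blk j) (\<lambda>_. mark_law)) (\<lambda>j x. restrict x (blk j)) UNIV"
    by (rule tree.indep_vars_restrict[OF indep_tree_coordinates])
      (auto simp: disjoint_family_on_def blk_def split: option.splits)
  moreover have "X j \<in> PiM (blk j) (\<lambda>_. mark_law) \<rightarrow>\<^sub>M count_space UNIV" for j
  proof (cases j)
    case None
    have "(\<lambda>y. y []) \<in> PiM {[]} (\<lambda>_. mark_law) \<rightarrow>\<^sub>M mark_law"
      by (rule measurable_component_singleton) simp
    then show ?thesis unfolding X_def None blk_def by simp
  next
    case (Some i)
    have "(\<lambda>y w. y (i # w)) \<in> PiM (range (Cons i)) (\<lambda>_. mark_law) \<rightarrow>\<^sub>M PiM UNIV (\<lambda>_. mark_law)"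
      by (rule measurable_PiM_single') (auto intro: measurable_component_singleton simp: space_PiM)
    then have [measurable]: "(\<lambda>y w. y (i # w)) \<in> PiM (range (Cons i)) (\<lambda>_. mark_law) \<rightarrow>\<^sub>M tree_space"
      unfolding tree_law_def[symmetric] by (simp cong: measurable_cong_sets add: sets_tree_law)
    show ?thesis unfolding X_def Some blk_def by simp
  qed
  ultimately have "tree.indep_vars (\<lambda>_. count_space UNIV) (\<lambda>j x. X j (restrict x (blk j))) UNIV"
    by (rule tree.indep_vars_compose2)
  moreover have "X j (restrict x (blk j)) = X j x" for j x
    by (auto simp: X_def blk_def split: option.split)
  ultimately have ind: "tree.indep_vars (\<lambda>_. count_space UNIV) X UNIV" by simp
  then have [measurable]: "X j \<in> tree_law \<rightarrow>\<^sub>M count_space UNIV" for j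
    by (auto simp: tree.indep_vars_def)
  have X_None: "tree.prob (X None -` {k} \<inter> space tree_law) = pmf p k" for k
  proof -
    have "emeasure tree_law (X None -` {k} \<inter> space tree_law)
        = emeasure (distr tree_law mark_law (\<lambda>x. x [])) (fst -` {k} \<inter> space mark_law)"
    proof (subst emeasure_distr)
      show "fst -` {k} \<inter> space mark_law \<in> sets mark_law"
        by (rule measurable_sets[of _ _ "count_space UNIV"]) auto
      show "(\<lambda>x. x []) \<in> tree_law \<rightarrow>\<^sub>M mark_law" unfolding tree_law_def by measurable
      have "x [] \<in> space mark_law" for x
        using sets_eq_imp_space_eq[OF sets_mark_law] by (simp add: space_pair_measure)
      then show "emeasure tree_law (X None -` {k} \<inter> space tree_law) =
        emeasure tree_law ((\<lambda>x. x []) -` (fst -` {k} \<inter> space mark_law) \<inter> space tree_law)"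
        by (intro arg_cong2[where f=emeasure] refl) (auto simp: X_def)
    qed
    also have "\<dots> = emeasure (measure_pmf p \<Otimes>\<^sub>M \<mu>) ({k} \<times> space \<mu>)"
      unfolding distr_tree_coordinate
      by (intro arg_cong2[where f=emeasure]) (auto simp: mark_law_def space_pair_measure)
    also have "\<dots> = ennreal (pmf p k)"
      by (subst \<mu>.emeasure_pair_measure_Times) (auto simp: emeasure_pmf_single \<mu>.emeasure_space_1)
    finally show ?thesis by (simp add: tree.emeasure_eq_measure)
  qed
  have X_Some: "tree.prob (X (Some i) -` {1} \<inter> space tree_law) = q" for i
  proof -
    have [measurable]: "(\<lambda>x w. x (i # w)) \<in> tree_law \<rightarrow>\<^sub>M tree_law"
      unfolding tree_law_def
      by (rule measurable_PiM_single') (auto intro: measurable_component_singleton simp: space_PiM)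
    have ms: "{x. tree_gen n x = {}} \<in> sets tree_law"
    proof -
      have "{x \<in> space tree_law. tree_gen n x = {}} \<in> sets tree_law" by measurable
      then show ?thesis by simp
    qed
    have "q = measure (distr tree_law tree_law (\<lambda>x w. x (i # w))) {x. tree_gen n x = {}}"
      by (simp add: q_def extinct_prob_def distr_subtree)
    also have "\<dots> = tree.prob ((\<lambda>x w. x (i # w)) -` {x. tree_gen n x = {}} \<inter> space tree_law)"
      using ms by (subst measure_distr) auto
    finally show ?thesis by (simp add: X_def vimage_def if_distrib cong: if_cong)
  qed
  \<comment> \<open>Marks exist at all labels, but only the subtrees of the \<open>k\<close> actual
    children must die out, so \<open>E k\<close> is a finite intersection of independent
    events.\<close>
  define E where "E k = {x. fst (x []) = k \<and> (\<forall>j<k. tree_gen n (\<lambda>w. x (j # w)) = {})}" for k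
  have prob_E: "E k \<in> sets tree_law \<and> tree.prob (E k) = pmf p k * q ^ k" for k
  proof -
    define J where "J = insert None (Some ` {..<k})"
    define S where "S j = (case j of None \<Rightarrow> {k} | Some _ \<Rightarrow> {1::nat})" for j :: "nat option"
    have E_eq: "E k = (\<Inter>j\<in>J. X j -` S j \<inter> space tree_law)"
      by (auto simp: E_def J_def S_def X_def split: if_splits)
    have "tree.prob (\<Inter>j\<in>J. X j -` S j \<inter> space tree_law) = (\<Prod>j\<in>J. tree.prob (X j -` S j \<inter> space tree_law))"
      by (rule tree.indep_varsD[OF ind]) (auto simp: J_def)
    also have "\<dots> = pmf p k * q ^ k"
      unfolding J_def by (subst prod.insert) (auto simp: S_def X_None[simplified] X_Some[simplified] prod.reindex)
    finally have "tree.prob (E k) = pmf p k * q ^ k" by (simp add: E_eq)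
    moreover have "E k \<in> sets tree_law"
      unfolding E_eq by (intro sets.finite_INT measurable_sets[where A="count_space UNIV"]) (auto simp: J_def)
    ultimately show ?thesis by simp
  qed
  have "{x. tree_gen (Suc n) x = {}} = (\<Union>k. E k)"
    by (auto simp: tree_gen_Suc_empty_iff E_def)
  then have "ennreal (extinct_prob (Suc n)) = emeasure tree_law (\<Union>k. E k)"
    by (simp add: extinct_prob_def tree.emeasure_eq_measure)
  also have "\<dots> = (\<Sum>k. emeasure tree_law (E k))"
    using prob_E by (intro suminf_emeasure[symmetric]) (auto simp: disjoint_family_on_def E_def)
  also have "\<dots> = (\<Sum>k. ennreal (pmf p k) * ennreal (q ^ k))"
    using prob_E q by (simp add: tree.emeasure_eq_measure ennreal_mult)
  also have "\<dots> = (\<integral>\<^sup>+k. ennreal (q ^ k) \<partial>measure_pmf p)"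
    by (simp add: nn_integral_measure_pmf nn_integral_count_space_nat)
  also have "\<dots> = ennreal (measure_pmf.expectation p (\<lambda>k. q ^ k))"
    using q by (intro nn_integral_eq_integral measure_pmf.integrable_const_bound[where B=1])
      (auto intro!: power_le_one)
  finally show ?thesis
    using q by (subst (asm) ennreal_inj) (auto simp: q_def extinct_prob_def[of "Suc n"]
       intro!: Bochner_Integration.integral_nonneg)
qed

lemma tendsto_survival_prob: "(\<lambda>n. real n * (1 - extinct_prob n)) \<longlonglongrightarrow> 2 / offspring_var"
  by (rule kolmogorov_survival_asymptotics) (simp_all add: extinct_prob_0 extinct_prob_Suc)

text \<open>First-moment method: the probability of a far particle is at most the expected number of
  such particles.\<close>

lemma far_particle_prob_le:
  assumes n: "1 \<le> n"
  shows "tree.prob {x. \<exists>v\<in>tree_gen n x. \<bar>tree_disp v x\<bar> > \<epsilon> * real n} \<le> tail_bound \<epsilon> n"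
proof -
  define E where "E v = {x. v \<in> tree_gen n x \<and> \<bar>tree_disp v x\<bar> > \<epsilon> * real n}" for v
  have ms: "E v \<in> sets tree_law" for v
  proof -
    have "E v = {x \<in> space tree_law. v \<in> tree_gen n x \<and> \<bar>tree_disp v x\<bar> > \<epsilon> * real n}"
      by (simp add: E_def)
    also have "\<dots> \<in> sets tree_law" by measurable
    finally show ?thesis .
  qed
  have "{x. \<exists>v\<in>tree_gen n x. \<bar>tree_disp v x\<bar> > \<epsilon> * real n} = (\<Union>v\<in>{v. length v = n}. E v)"
    by (auto simp: E_def tree_gen_def)
  then have "emeasure tree_law {x. \<exists>v\<in>tree_gen n x. \<bar>tree_disp v x\<bar> > \<epsilon> * real n}
      \<le> (\<integral>\<^sup>+v. emeasure tree_law (E v) \<partial>count_space {v. length v = n})"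
    using ms by (simp add: emeasure_UN_countable_le)
  also have "\<dots> \<le> ennreal (tail_bound \<epsilon> n)"
    unfolding E_def using n by (rule sum_path_tail_le)
  finally show ?thesis by (simp add: tree.emeasure_eq_measure tail_bound_nonneg)
qed

end

subsection \<open>Poisson initial configuration\<close>

text \<open>Generating function of the Poisson law. With \<open>g\<close> the probability that a
  tree has a given property, it is the thinning formula for all trees having it.\<close>

lemma nn_integral_poisson_power:
  fixes rate :: real
  assumes rate: "0 < rate" and g: "0 \<le> g"
  shows "(\<Sum>k. ennreal (g ^ k) * ennreal (pmf (poisson_pmf rate) k)) = ennreal (exp (- (1 - g) * rate))"
proof -
  have "(\<lambda>k. (g * rate) ^ k /\<^sub>R fact k) sums exp (g * rate)" by (rule exp_converges)
  then have "(\<lambda>k. (g * rate) ^ k /\<^sub>R fact k * exp (- rate)) sums (exp (g * rate) * exp (- rate))"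
    by (rule sums_mult2)
  then have "(\<lambda>k. g ^ k * pmf (poisson_pmf rate) k) sums exp (- (1 - g) * rate)"
    using rate by (simp add: pmf_poisson power_mult_distrib field_simps flip: exp_add)
  then show ?thesis
    using g by (subst suminf_ennreal_eq[symmetric]) (auto simp: ennreal_mult)
qed

lemma nn_integral_poisson_mean:
  fixes rate :: real
  assumes rate: "0 < rate"
  shows "(\<integral>\<^sup>+k. of_nat k \<partial>measure_pmf (poisson_pmf rate)) = ennreal rate"
proof -
  have "(\<lambda>k. rate ^ k /\<^sub>R fact k) sums exp rate" by (rule exp_converges)
  then have "(\<lambda>k. rate ^ k /\<^sub>R fact k * (rate * exp (- rate))) sums (exp rate * (rate * exp (- rate)))"
    by (rule sums_mult2)
  also have "exp rate * (rate * exp (- rate)) = rate" by (simp add: exp_minus)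
  also have "(\<lambda>k. rate ^ k /\<^sub>R fact k * (rate * exp (- rate))) = (\<lambda>k. real (Suc k) * pmf (poisson_pmf rate) (Suc k))"
  proof
    fix k
    have "real (Suc k) * pmf (poisson_pmf rate) (Suc k)
        = (real (Suc k) / fact (Suc k)) * rate ^ Suc k * exp (- rate)"
      using rate by (simp add: pmf_poisson)
    also have "real (Suc k) / fact (Suc k) = 1 / fact k" by (simp add: fact_Suc del: of_nat_Suc)
    finally show "rate ^ k /\<^sub>R fact k * (rate * exp (- rate)) = real (Suc k) * pmf (poisson_pmf rate) (Suc k)"
      by (simp add: divide_inverse mult_ac)
  qed
  finally have "(\<lambda>k. real k * pmf (poisson_pmf rate) k) sums rate"
    by (subst (asm) sums_Suc_iff) simp
  then have "(\<Sum>k. ennreal (real k * pmf (poisson_pmf rate) k)) = ennreal rate"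
    by (subst suminf_ennreal_eq[symmetric]) auto
  then show ?thesis
    by (simp add: nn_integral_measure_pmf nn_integral_count_space_nat ennreal_mult
        ennreal_of_nat_eq_real_of_nat mult.commute)
qed

locale poisson_branching_walk = branching_walk p \<mu> \<alpha> + prob_space M
  for p \<mu> \<alpha> and M :: "'a measure" +
  fixes \<xi> :: "nat \<Rightarrow> 'a \<Rightarrow> real" and K :: "nat \<Rightarrow> nat list \<Rightarrow> 'a \<Rightarrow> nat"
    and D :: "nat \<Rightarrow> nat list \<Rightarrow> 'a \<Rightarrow> real"
  assumes poisson_\<xi>: "poisson_point_seq M \<xi>"
    and indep_marks: "indep_vars (\<lambda>_. mark_space) (\<lambda>(i, v) \<omega>. (K i v \<omega>, D i v \<omega>)) UNIV"
    and distr_mark: "\<And>i v. distr M mark_space (\<lambda>\<omega>. (K i v \<omega>, D i v \<omega>)) = measure_pmf p \<Otimes>\<^sub>M \<mu>"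
    and indep_\<xi>_marks: "indep_set
        {(\<lambda>\<omega> i. \<xi> i \<omega>) -` S \<inter> space M | S. S \<in> sets (Pi\<^sub>M UNIV (\<lambda>_. borel))}
        {(\<lambda>\<omega> (iv :: nat \<times> nat list). (K (fst iv) (snd iv) \<omega>, D (fst iv) (snd iv) \<omega>)) -` S \<inter> space M
           | S. S \<in> sets (Pi\<^sub>M UNIV (\<lambda>_. mark_space))}"
begin

definition tree :: "nat \<Rightarrow> 'a \<Rightarrow> nat list \<Rightarrow> nat \<times> real" where
  "tree i \<omega> = (\<lambda>v. (K i v \<omega>, D i v \<omega>))"

abbreviation marks :: "'a \<Rightarrow> nat \<times> nat list \<Rightarrow> nat \<times> real" where
  "marks \<equiv> \<lambda>\<omega> iv. (K (fst iv) (snd iv) \<omega>, D (fst iv) (snd iv) \<omega>)"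

lemma indep_marks': "indep_vars (\<lambda>_. mark_space) (\<lambda>iv \<omega>. marks \<omega> iv) UNIV"
proof -
  have "(\<lambda>(i, v) \<omega>. (K i v \<omega>, D i v \<omega>)) = (\<lambda>iv \<omega>. marks \<omega> iv)" by (auto simp: fun_eq_iff)
  then show ?thesis using indep_marks by simp
qed

lemma measurable_mark [measurable]: "(\<lambda>\<omega>. marks \<omega> iv) \<in> M \<rightarrow>\<^sub>M mark_space"
  using indep_marks' by (auto simp: indep_vars_def)

lemma measurable_\<xi> [measurable]: "\<xi> i \<in> borel_measurable M"
  using poisson_\<xi> by (auto simp: poisson_point_seq_def)

text \<open>Independence includes measurability, so the independence clause of
  \<open>poisson_point_seq\<close> is applied to a family of one set.\<close>

lemma measurable_card_points:
  assumes "A \<in> sets borel" "bounded A"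
  shows "(\<lambda>\<omega>. card {i. \<xi> i \<omega> \<in> A}) \<in> M \<rightarrow>\<^sub>M count_space UNIV"
proof -
  have "indep_vars (\<lambda>_. count_space UNIV) (\<lambda>j \<omega>. card {i. \<xi> i \<omega> \<in> A}) {..<Suc 0}"
    using poisson_\<xi> assms unfolding poisson_point_seq_def
    by (elim conjE allE[where x="Suc 0"] allE[where x="\<lambda>_. A"]) (auto simp: disjoint_family_on_def)
  then show ?thesis by (auto simp: indep_vars_def)
qed

lemma measurable_marks [measurable]: "marks \<in> M \<rightarrow>\<^sub>M PiM UNIV (\<lambda>_. mark_space)"
  by (rule measurable_PiM_single') (auto simp: space_pair_measure)

lemma measurable_tree [measurable]: "tree i \<in> M \<rightarrow>\<^sub>M tree_space"
  unfolding tree_def using measurable_mark[of "(i, _)"]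
  by (intro measurable_PiM_single') (auto simp: space_pair_measure)

lemma distr_tree: "distr M tree_space (tree i) = tree_law"
proof -
  have "distr M (PiM UNIV (\<lambda>_. mark_space)) (\<lambda>\<omega>. \<lambda>iv\<in>UNIV. marks \<omega> iv)
      = PiM UNIV (\<lambda>iv. distr M mark_space (\<lambda>\<omega>. marks \<omega> iv))"
    using indep_marks' by (subst (asm) indep_vars_iff_distr_eq_PiM) auto
  then have marks: "distr M (PiM UNIV (\<lambda>_. mark_space)) marks = PiM UNIV (\<lambda>_. mark_law)"
    by (simp add: distr_mark mark_law_def restrict_UNIV)
  have meas: "(\<lambda>x v. x (i, v)) \<in> PiM UNIV (\<lambda>_. mark_space) \<rightarrow>\<^sub>M tree_space"
    by (rule measurable_PiM_single') (auto simp: space_pair_measure)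
  have "distr M tree_space (tree i) = distr (distr M (PiM UNIV (\<lambda>_. mark_space)) marks) tree_space (\<lambda>x v. x (i, v))"
    using meas by (subst distr_distr) (auto simp: comp_def tree_def[abs_def])
  also have "\<dots> = distr (PiM UNIV (\<lambda>_. mark_law)) (PiM UNIV (\<lambda>_. mark_law)) (\<lambda>x. \<lambda>v\<in>UNIV. x (i, v))"
    unfolding marks by (intro distr_cong refl) (auto intro!: sets_PiM_cong simp: sets_mark_law)
  also have "\<dots> = PiM UNIV (\<lambda>_. mark_law)"
    using distr_PiM_reindex[of UNIV "\<lambda>_. mark_law" "\<lambda>v. (i, v)" UNIV] mark.prob_space_axioms
    by (simp add: inj_on_def)
  finally show ?thesis by (simp add: tree_law_def)
qed

lemma prob_tree:
  assumes "G \<in> sets tree_space"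
  shows "prob (tree i -` G \<inter> space M) = measure tree_law G"
  using assms by (simp add: measure_distr flip: distr_tree[of i])

lemma indep_trees: "indep_vars (\<lambda>_. tree_space) tree UNIV"
proof -
  have "indep_vars (\<lambda>i. PiM ({i} \<times> UNIV) (\<lambda>_. mark_space)) (\<lambda>i \<omega>. restrict (marks \<omega>) ({i} \<times> UNIV)) UNIV"
    by (rule indep_vars_restrict[OF indep_marks']) (auto simp: disjoint_family_on_def)
  then have "indep_vars (\<lambda>_. tree_space) (\<lambda>i \<omega> v. restrict (marks \<omega>) ({i} \<times> UNIV) (i, v)) UNIV"
  proof (rule indep_vars_compose2)
    show "(\<lambda>x v. x (i, v)) \<in> PiM ({i} \<times> UNIV) (\<lambda>_. mark_space) \<rightarrow>\<^sub>M tree_space" for i :: nat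
      by (rule measurable_PiM_single') (auto intro: measurable_component_singleton simp: space_pair_measure)
  qed
  then show ?thesis by (simp add: tree_def[abs_def])
qed

text \<open>Independence of configuration and marks, restated for one root and its tree as a product
  law, which is the form needed for Fubini.\<close>

lemma distr_\<xi>_tree:
  "distr M borel (\<xi> i) \<Otimes>\<^sub>M tree_law = distr M (borel \<Otimes>\<^sub>M tree_space) (\<lambda>\<omega>. (\<xi> i \<omega>, tree i \<omega>))"
proof (rule pair_measure_eqI)
  interpret L: prob_space "distr M borel (\<xi> i)" by (rule prob_space_distr) simp
  show "sigma_finite_measure (distr M borel (\<xi> i))" by (rule L.sigma_finite_measure_axioms)
  show "sigma_finite_measure tree_law" by (rule tree.sigma_finite_measure_axioms)
  show "sets (distr M borel (\<xi> i) \<Otimes>\<^sub>M tree_law) = sets (distr M (borel \<Otimes>\<^sub>M tree_space) (\<lambda>\<omega>. (\<xi> i \<omega>, tree i \<omega>)))"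
    by (simp cong: sets_pair_measure_cong add: sets_tree_law)
  fix A B assume "A \<in> sets (distr M borel (\<xi> i))" "B \<in> sets tree_law"
  then have [measurable]: "A \<in> sets borel" "B \<in> sets tree_space" by (auto simp: sets_tree_law)
  have proj: "(\<lambda>x v. x (i, v)) \<in> PiM UNIV (\<lambda>_. mark_space) \<rightarrow>\<^sub>M tree_space"
    by (rule measurable_PiM_single') (auto simp: space_pair_measure)
  define S where "S = (\<lambda>x. x i) -` A \<inter> space (PiM UNIV (\<lambda>_::nat. borel :: real measure))"
  define S' where "S' = (\<lambda>x v. x (i, v)) -` B \<inter> space (PiM UNIV (\<lambda>_::nat \<times> nat list. mark_space))"
  have "S \<in> sets (PiM UNIV (\<lambda>_. borel))" unfolding S_def by measurable
  moreover have "S' \<in> sets (PiM UNIV (\<lambda>_. mark_space))"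
    unfolding S'_def by (rule measurable_sets[OF proj]) simp
  moreover have "\<xi> i -` A \<inter> space M = (\<lambda>\<omega> i. \<xi> i \<omega>) -` S \<inter> space M" "tree i -` B \<inter> space M = marks -` S' \<inter> space M"
    by (auto simp: S_def S'_def tree_def space_PiM space_pair_measure)
  ultimately have "prob ((\<xi> i -` A \<inter> space M) \<inter> (tree i -` B \<inter> space M))
      = prob (\<xi> i -` A \<inter> space M) * prob (tree i -` B \<inter> space M)"
    by (intro indep_setD[OF indep_\<xi>_marks]) blast+
  moreover have "(\<lambda>\<omega>. (\<xi> i \<omega>, tree i \<omega>)) -` (A \<times> B) \<inter> space M = (\<xi> i -` A \<inter> space M) \<inter> (tree i -` B \<inter> space M)"
    by auto
  ultimately show "emeasure (distr M borel (\<xi> i)) A * emeasure tree_law B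
      = emeasure (distr M (borel \<Otimes>\<^sub>M tree_space) (\<lambda>\<omega>. (\<xi> i \<omega>, tree i \<omega>))) (A \<times> B)"
    by (simp add: emeasure_distr emeasure_eq_measure tree.emeasure_eq_measure ennreal_mult prob_tree)
qed

text \<open>Conditionally on the initial configuration the trees rooted in \<open>A\<close> are i.i.d., so the
  probability is the generating function of the Poisson number of points in \<open>A\<close>. The
  configurations are enumerated by the finite set of indices of the points in \<open>A\<close>.\<close>

lemma prob_all_trees_in:
  assumes A: "A \<in> sets borel" "bounded A" "0 < measure lborel A" and G: "G \<in> sets tree_space"
  shows "prob {\<omega> \<in> space M. \<forall>i. \<xi> i \<omega> \<in> A \<longrightarrow> tree i \<omega> \<in> G}
    = exp (- (1 - measure tree_law G) * measure lborel A)"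
proof -
  define g where "g = measure tree_law G"
  note [measurable] = A(1) G
  have fin: "AE \<omega> in M. finite {i. \<xi> i \<omega> \<in> A}"
    and dist: "distr M (count_space UNIV) (\<lambda>\<omega>. card {i. \<xi> i \<omega> \<in> A}) = measure_pmf (poisson_pmf (measure lborel A))"
    using poisson_\<xi> A by (auto simp: poisson_point_seq_def)
  note [measurable] = measurable_card_points[OF A(1,2)]
  define E where "E I = {\<omega> \<in> space M. \<forall>i. \<xi> i \<omega> \<in> A \<longleftrightarrow> i \<in> I}" for I
  define F where "F I = {\<omega> \<in> space M. \<forall>i\<in>I. tree i \<omega> \<in> G}" for I
  define Fin where "Fin k = {I :: nat set. finite I \<and> card I = k}" for k
  have cFin: "countable (Fin k)" for k
    unfolding Fin_def by (rule countable_subset[OF _ countable_Collect_finite]) auto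
  have E_sets [measurable]: "E I \<in> sets M" for I unfolding E_def by measurable
  have F_sets [measurable]: "F I \<in> sets M" for I unfolding F_def by measurable
  have prob_F: "prob (F I) = g ^ card I" if "finite I" for I
  proof (cases "I = {}")
    case True
    then show ?thesis by (simp add: F_def prob_space)
  next
    case False
    have "F I = (\<Inter>i\<in>I. tree i -` G \<inter> space M)" using False by (auto simp: F_def)
    then have "prob (F I) = (\<Prod>i\<in>I. prob (tree i -` G \<inter> space M))"
      using indep_varsD[OF indep_trees False that] G by simp
    also have "\<dots> = g ^ card I" using G by (simp add: prob_tree g_def)
    finally show ?thesis .
  qed
  \<comment> \<open>\<open>E I\<close> is determined by the configuration and \<open>F I\<close> by
    the marks.\<close>
  have prob_EF: "prob (E I \<inter> F I) = g ^ card I * prob (E I)" if "finite I" for I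
  proof -
    define S where "S = {x :: nat \<Rightarrow> real. \<forall>i. x i \<in> A \<longleftrightarrow> i \<in> I}"
    define S' where "S' = {x :: nat \<times> nat list \<Rightarrow> nat \<times> real. \<forall>i\<in>I. (\<lambda>v. x (i, v)) \<in> G}"
    have "{x \<in> space (PiM UNIV (\<lambda>_. borel)). \<forall>i. x i \<in> A \<longleftrightarrow> i \<in> I} \<in> sets (PiM UNIV (\<lambda>_. borel :: real measure))"
      by measurable
    then have "S \<in> sets (PiM UNIV (\<lambda>_. borel))" by (simp add: S_def space_PiM)
    moreover have [measurable]: "(\<lambda>x v. x (i, v)) \<in> PiM UNIV (\<lambda>_. mark_space) \<rightarrow>\<^sub>M tree_space" for i :: nat
      by (rule measurable_PiM_single') (auto simp: space_pair_measure)
    have "{x \<in> space (PiM UNIV (\<lambda>_. mark_space)). \<forall>i\<in>I. (\<lambda>v. x (i, v)) \<in> G} \<in> sets (PiM UNIV (\<lambda>_. mark_space))"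
      by measurable
    then have "S' \<in> sets (PiM UNIV (\<lambda>_. mark_space))" by (simp add: S'_def space_PiM space_pair_measure)
    moreover have "E I = (\<lambda>\<omega> i. \<xi> i \<omega>) -` S \<inter> space M" "F I = marks -` S' \<inter> space M"
      by (auto simp: E_def S_def F_def S'_def tree_def)
    ultimately have "prob (E I \<inter> F I) = prob (E I) * prob (F I)"
      by (intro indep_setD[OF indep_\<xi>_marks]) blast+
    then show ?thesis by (simp add: prob_F that)
  qed
  have disj: "disjoint_family_on E (Fin k)" "disjoint_family_on (\<lambda>I. E I \<inter> F I) (Fin k)" for k
    by (auto simp: disjoint_family_on_def E_def)
  have H: "emeasure M (\<Union>I\<in>Fin k. E I \<inter> F I) = ennreal (g ^ k) * ennreal (pmf (poisson_pmf (measure lborel A)) k)" for k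
  proof -
    have "emeasure M (\<Union>I\<in>Fin k. E I \<inter> F I) = (\<integral>\<^sup>+I. emeasure M (E I \<inter> F I) \<partial>count_space (Fin k))"
      by (intro emeasure_UN_countable cFin disj) auto
    also have "\<dots> = (\<integral>\<^sup>+I. ennreal (g ^ k) * emeasure M (E I) \<partial>count_space (Fin k))"
      by (intro nn_integral_cong)
        (auto simp: Fin_def emeasure_eq_measure prob_EF ennreal_mult g_def)
    also have "\<dots> = ennreal (g ^ k) * emeasure M (\<Union>I\<in>Fin k. E I)"
      by (subst emeasure_UN_countable[OF _ cFin disj(1)]) (auto simp: nn_integral_cmult)
    \<comment> \<open>Since \<open>card\<close> is 0 on infinite sets, for \<open>k = 0\<close> the
      two events agree only up to the null event that infinitely many points lie in
      \<open>A\<close>.\<close>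
    also have "emeasure M (\<Union>I\<in>Fin k. E I) = emeasure M ((\<lambda>\<omega>. card {i. \<xi> i \<omega> \<in> A}) -` {k} \<inter> space M)"
    proof (rule emeasure_eq_AE)
      show "AE \<omega> in M. (\<omega> \<in> (\<Union>I\<in>Fin k. E I)) = (\<omega> \<in> (\<lambda>\<omega>. card {i. \<xi> i \<omega> \<in> A}) -` {k} \<inter> space M)"
        using fin
      proof (rule AE_mp, intro AE_I2 impI)
        fix \<omega> assume \<omega>: "\<omega> \<in> space M" "finite {i. \<xi> i \<omega> \<in> A}"
        have "\<omega> \<in> E I \<longleftrightarrow> I = {i. \<xi> i \<omega> \<in> A}" for I using \<omega> by (auto simp: E_def)
        then show "(\<omega> \<in> (\<Union>I\<in>Fin k. E I)) = (\<omega> \<in> (\<lambda>\<omega>. card {i. \<xi> i \<omega> \<in> A}) -` {k} \<inter> space M)"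
          using \<omega> by (auto simp: Fin_def)
      qed
      show "(\<Union>I\<in>Fin k. E I) \<in> events" by (intro sets.countable_UN'' cFin) auto
    qed auto
    also have "\<dots> = emeasure (distr M (count_space UNIV) (\<lambda>\<omega>. card {i. \<xi> i \<omega> \<in> A})) {k}"
      by (subst emeasure_distr) auto
    also have "\<dots> = ennreal (pmf (poisson_pmf (measure lborel A)) k)"
      unfolding dist by (rule emeasure_pmf_single)
    finally show ?thesis .
  qed
  have "emeasure M {\<omega> \<in> space M. \<forall>i. \<xi> i \<omega> \<in> A \<longrightarrow> tree i \<omega> \<in> G} = emeasure M (\<Union>k. \<Union>I\<in>Fin k. E I \<inter> F I)"
  proof (rule emeasure_eq_AE)
    show "AE \<omega> in M. (\<omega> \<in> {\<omega> \<in> space M. \<forall>i. \<xi> i \<omega> \<in> A \<longrightarrow> tree i \<omega> \<in> G}) = (\<omega> \<in> (\<Union>k. \<Union>I\<in>Fin k. E I \<inter> F I))"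
      using fin
    proof (rule AE_mp, intro AE_I2 impI)
      fix \<omega> assume \<omega>: "\<omega> \<in> space M" "finite {i. \<xi> i \<omega> \<in> A}"
      have "\<omega> \<in> E I \<longleftrightarrow> I = {i. \<xi> i \<omega> \<in> A}" for I using \<omega> by (auto simp: E_def)
      then show "(\<omega> \<in> {\<omega> \<in> space M. \<forall>i. \<xi> i \<omega> \<in> A \<longrightarrow> tree i \<omega> \<in> G}) = (\<omega> \<in> (\<Union>k. \<Union>I\<in>Fin k. E I \<inter> F I))"
        using \<omega> by (auto simp: Fin_def F_def)
    qed
    show "(\<Union>k. \<Union>I\<in>Fin k. E I \<inter> F I) \<in> events"
      by (intro sets.countable_UN'' cFin) auto
  qed measurable
  also have "\<dots> = (\<Sum>k. emeasure M (\<Union>I\<in>Fin k. E I \<inter> F I))"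
  proof (rule suminf_emeasure[symmetric])
    show "range (\<lambda>k. \<Union>I\<in>Fin k. E I \<inter> F I) \<subseteq> events"
      by (auto intro!: sets.countable_UN'' cFin)
    have "I = J" if "\<omega> \<in> E I" "\<omega> \<in> E J" for I J \<omega> using that by (auto simp: E_def)
    then show "disjoint_family (\<lambda>k. \<Union>I\<in>Fin k. E I \<inter> F I)"
      by (force simp: disjoint_family_on_def Fin_def)
  qed
  also have "\<dots> = ennreal (exp (- (1 - g) * measure lborel A))"
    unfolding H by (rule nn_integral_poisson_power) (auto simp: A g_def)
  finally show ?thesis by (simp add: emeasure_eq_measure g_def)
qed

text \<open>Nothing is assumed about the law of a single \<open>\<xi> i\<close>; only the sum of
  these laws is determined, being the mean of the Poisson count after exchanging sum and
  expectation.\<close>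

lemma intensity:
  assumes A: "A \<in> sets borel" "bounded A" "0 < measure lborel A"
  shows "(\<Sum>i. emeasure M {\<omega> \<in> space M. \<xi> i \<omega> \<in> A}) = ennreal (measure lborel A)"
proof -
  note [measurable] = A(1)
  have fin: "AE \<omega> in M. finite {i. \<xi> i \<omega> \<in> A}"
    and dist: "distr M (count_space UNIV) (\<lambda>\<omega>. card {i. \<xi> i \<omega> \<in> A}) = measure_pmf (poisson_pmf (measure lborel A))"
    using poisson_\<xi> A by (auto simp: poisson_point_seq_def)
  note [measurable] = measurable_card_points[OF A(1,2)]
  have "(\<Sum>i. emeasure M {\<omega> \<in> space M. \<xi> i \<omega> \<in> A}) = (\<Sum>i. \<integral>\<^sup>+\<omega>. indicator A (\<xi> i \<omega>) \<partial>M)"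
    by (intro suminf_cong) (auto simp: indicator_def of_bool_def simp flip: nn_integral_indicator intro!: nn_integral_cong)
  also have "\<dots> = (\<integral>\<^sup>+\<omega>. (\<Sum>i. indicator A (\<xi> i \<omega>)) \<partial>M)"
    by (rule nn_integral_suminf[symmetric]) measurable
  also have "\<dots> = (\<integral>\<^sup>+\<omega>. of_nat (card {i. \<xi> i \<omega> \<in> A}) \<partial>M)"
  proof (rule nn_integral_cong_AE, use fin in \<open>rule AE_mp\<close>, intro AE_I2 impI)
    fix \<omega> assume fin: "finite {i. \<xi> i \<omega> \<in> A}"
    have "(\<Sum>i. indicator A (\<xi> i \<omega>) :: ennreal) = (\<Sum>i\<in>{i. \<xi> i \<omega> \<in> A}. indicator A (\<xi> i \<omega>))"
      by (rule suminf_finite[OF fin]) auto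
    also have "\<dots> = of_nat (card {i. \<xi> i \<omega> \<in> A})" by simp
    finally show "(\<Sum>i. indicator A (\<xi> i \<omega>) :: ennreal) = of_nat (card {i. \<xi> i \<omega> \<in> A})" .
  qed
  also have "\<dots> = (\<integral>\<^sup>+k. of_nat k \<partial>distr M (count_space UNIV) (\<lambda>\<omega>. card {i. \<xi> i \<omega> \<in> A}))"
    by (subst nn_integral_distr) auto
  also have "\<dots> = ennreal (measure lborel A)"
    unfolding dist using A by (rule_tac nn_integral_poisson_mean)
  finally show ?thesis .
qed

text \<open>Given its tree, the root must lie in an interval of length \<open>2 * a\<close> whose
  position depends on the tree alone. Summed over all roots this costs \<open>2 * a\<close> whatever
  the shift \<open>S\<close>, so arbitrarily distant roots are covered.\<close>

lemma campbell_shifted_interval: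
  assumes E [measurable]: "Measurable.pred tree_space E" and S [measurable]: "S \<in> borel_measurable tree_space"
    and a: "0 < a"
  shows "(\<Sum>i. emeasure M {\<omega> \<in> space M. E (tree i \<omega>) \<and> \<bar>\<xi> i \<omega> + S (tree i \<omega>)\<bar> < a})
    = ennreal (2 * a) * emeasure tree_law {x. E x}"
proof -
  have E_sets: "{x. E x} \<in> sets tree_law"
  proof -
    have "{x \<in> space tree_law. E x} \<in> sets tree_law" by measurable
    then show ?thesis by simp
  qed
  have eq: "emeasure M {\<omega> \<in> space M. E (tree i \<omega>) \<and> \<bar>\<xi> i \<omega> + S (tree i \<omega>)\<bar> < a}
      = (\<integral>\<^sup>+x. indicator {x. E x} x * emeasure M {\<omega> \<in> space M. \<xi> i \<omega> \<in> {- a - S x<..<a - S x}} \<partial>tree_law)" for i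
  proof -
    have joint: "distr M (borel \<Otimes>\<^sub>M tree_space) (\<lambda>\<omega>. (\<xi> i \<omega>, tree i \<omega>)) = distr M borel (\<xi> i) \<Otimes>\<^sub>M tree_law"
      by (rule distr_\<xi>_tree[symmetric])
    interpret L: prob_space "distr M borel (\<xi> i)" by (rule prob_space_distr) simp
    interpret P: pair_prob_space "distr M borel (\<xi> i)" tree_law ..
    define Q where "Q = {y \<in> space (borel \<Otimes>\<^sub>M tree_space). E (snd y) \<and> \<bar>fst y + S (snd y)\<bar> < a}"
    have Q: "Q \<in> sets (borel \<Otimes>\<^sub>M tree_space)" unfolding Q_def by measurable
    have "emeasure M {\<omega> \<in> space M. E (tree i \<omega>) \<and> \<bar>\<xi> i \<omega> + S (tree i \<omega>)\<bar> < a}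
        = emeasure (distr M (borel \<Otimes>\<^sub>M tree_space) (\<lambda>\<omega>. (\<xi> i \<omega>, tree i \<omega>))) Q"
      using Q by (subst emeasure_distr)
        (auto simp: Q_def space_pair_measure space_PiM intro!: arg_cong2[where f=emeasure])
    also have "\<dots> = (\<integral>\<^sup>+x. emeasure (distr M borel (\<xi> i)) ((\<lambda>y. (y, x)) -` Q) \<partial>tree_law)"
      unfolding joint using Q
      by (intro P.emeasure_pair_measure_alt2) (simp cong: sets_pair_measure_cong add: sets_tree_law)
    also have "\<dots> = (\<integral>\<^sup>+x. indicator {x. E x} x * emeasure M {\<omega> \<in> space M. \<xi> i \<omega> \<in> {- a - S x<..<a - S x}} \<partial>tree_law)"
    proof (rule nn_integral_cong)
      fix x
      have "(\<lambda>y. (y, x)) -` Q = (if E x then {- a - S x<..<a - S x} else {})"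
        by (auto simp: Q_def space_pair_measure space_PiM abs_less_iff)
      then show "emeasure (distr M borel (\<xi> i)) ((\<lambda>y. (y, x)) -` Q)
          = indicator {x. E x} x * emeasure M {\<omega> \<in> space M. \<xi> i \<omega> \<in> {- a - S x<..<a - S x}}"
        by (auto simp: emeasure_distr vimage_def Int_def conj_commute intro!: arg_cong2[where f=emeasure])
    qed
    finally show ?thesis .
  qed
  have meas: "(\<lambda>x. emeasure M {\<omega> \<in> space M. \<xi> i \<omega> \<in> {- a - S x<..<a - S x}}) \<in> borel_measurable tree_law" for i
    unfolding greaterThanLessThan_iff by measurable
  have "(\<Sum>i. emeasure M {\<omega> \<in> space M. E (tree i \<omega>) \<and> \<bar>\<xi> i \<omega> + S (tree i \<omega>)\<bar> < a})
      = (\<integral>\<^sup>+x. (\<Sum>i. indicator {x. E x} x * emeasure M {\<omega> \<in> space M. \<xi> i \<omega> \<in> {- a - S x<..<a - S x}}) \<partial>tree_law)"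
    unfolding eq using meas E_sets by (intro nn_integral_suminf[symmetric]) auto
  also have "\<dots> = (\<integral>\<^sup>+x. indicator {x. E x} x * ennreal (2 * a) \<partial>tree_law)"
  proof (rule nn_integral_cong)
    fix x
    have "(\<Sum>i. emeasure M {\<omega> \<in> space M. \<xi> i \<omega> \<in> {- a - S x<..<a - S x}}) = ennreal (2 * a)"
      using a by (subst intensity) (auto simp: bounded_Ioo)
    then show "(\<Sum>i. indicator {x. E x} x * emeasure M {\<omega> \<in> space M. \<xi> i \<omega> \<in> {- a - S x<..<a - S x}})
        = indicator {x. E x} x * ennreal (2 * a)"
      by (simp add: ennreal_suminf_cmult)
  qed
  also have "\<dots> = ennreal (2 * a) * emeasure tree_law {x. E x}"
    using E_sets by (simp add: nn_integral_multc mult.commute)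
  finally show ?thesis .
qed

end

text \<open>The supremum is attained: balls are open, so particles at distance exactly
  \<open>a\<close> do not spoil the radius \<open>a\<close>. Conversely, each particle's distance
  from the origin bounds all empty radii.\<close>

lemma brw_R_ge_iff:
  assumes a: "0 < a"
  shows "ereal a \<le> brw_R \<xi> K D n \<omega>
    \<longleftrightarrow> (\<forall>i. \<forall>v\<in>gen_particles K i n \<omega>. a \<le> \<bar>particle_pos \<xi> D i v \<omega>\<bar>)"
proof -
  have Z: "brw_Z \<xi> K D n \<omega> (ball 0 u) = 0
      \<longleftrightarrow> (\<forall>i. \<forall>v\<in>gen_particles K i n \<omega>. u \<le> \<bar>particle_pos \<xi> D i v \<omega>\<bar>)" for u
    by (auto simp: brw_Z_def emeasure_count_space_eq_0 not_less)
  show ?thesis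
  proof
    assume le: "ereal a \<le> brw_R \<xi> K D n \<omega>"
    show "\<forall>i. \<forall>v\<in>gen_particles K i n \<omega>. a \<le> \<bar>particle_pos \<xi> D i v \<omega>\<bar>"
    proof (intro allI ballI)
      fix i v assume "v \<in> gen_particles K i n \<omega>"
      then have "brw_R \<xi> K D n \<omega> \<le> ereal \<bar>particle_pos \<xi> D i v \<omega>\<bar>"
        unfolding brw_R_def Z by (intro Sup_least) auto
      with le have "ereal a \<le> ereal \<bar>particle_pos \<xi> D i v \<omega>\<bar>" by (rule order_trans)
      then show "a \<le> \<bar>particle_pos \<xi> D i v \<omega>\<bar>" by simp
    qed
  next
    assume "\<forall>i. \<forall>v\<in>gen_particles K i n \<omega>. a \<le> \<bar>particle_pos \<xi> D i v \<omega>\<bar>"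
    then show "ereal a \<le> brw_R \<xi> K D n \<omega>"
      unfolding brw_R_def Z using a by (intro Sup_upper) auto
  qed
qed

section \<open>Two-sided bounds for the empty-ball probability and the limit\<close>

context poisson_branching_walk
begin

definition empty_ball :: "nat \<Rightarrow> real \<Rightarrow> 'a set" where
  "empty_ball n a = {\<omega> \<in> space M. \<forall>i. \<forall>v\<in>tree_gen n (tree i \<omega>). a \<le> \<bar>\<xi> i \<omega> + tree_disp v (tree i \<omega>)\<bar>}"

lemma empty_ball_eq:
  assumes "0 < a"
  shows "empty_ball n a = {\<omega> \<in> space M. ereal a \<le> brw_R \<xi> K D n \<omega>}"
proof -
  have "tree_gen n (tree i \<omega>) = gen_particles K i n \<omega>" for i \<omega>
    by (simp add: tree_gen_def gen_particles_def tree_def)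
  moreover have "\<xi> i \<omega> + tree_disp v (tree i \<omega>) = particle_pos \<xi> D i v \<omega>" for i v \<omega>
    by (simp add: tree_disp_def particle_pos_def tree_def)
  ultimately show ?thesis using assms by (simp add: empty_ball_def brw_R_ge_iff)
qed

lemma sets_empty_ball [measurable]: "empty_ball n a \<in> events"
  unfolding empty_ball_def Ball_def by measurable

lemma Collect_in_sets_tree_space:
  assumes "Measurable.pred tree_space P"
  shows "{x. P x} \<in> sets tree_space"
  using predE[OF assms] by (simp add: space_PiM space_pair_measure)

text \<open>The ball of radius \<open>a\<close> is empty unless a tree rooted within distance \<open>a + \<epsilon> n\<close> survives
  or a particle displaced by more than \<open>\<epsilon> n\<close> lands in the ball.\<close>

lemma prob_empty_ball_ge:
  assumes n: "1 \<le> n" and a: "0 < a" and \<epsilon>: "0 < \<epsilon>"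
  shows "exp (- (1 - extinct_prob n) * (2 * (a + \<epsilon> * real n))) - 2 * a * tail_bound \<epsilon> n
    \<le> prob (empty_ball n a)"
proof -
  define c where "c = a + \<epsilon> * real n"
  have c: "0 < c" using a \<epsilon> by (simp add: c_def add_pos_nonneg)
  define good where "good = {\<omega> \<in> space M. \<forall>i. \<xi> i \<omega> \<in> {-c<..<c} \<longrightarrow> tree i \<omega> \<in> {x. tree_gen n x = {}}}"
  define bad where "bad v i = {\<omega> \<in> space M. (v \<in> tree_gen n (tree i \<omega>) \<and> \<bar>tree_disp v (tree i \<omega>)\<bar> > \<epsilon> * real n)
      \<and> \<bar>\<xi> i \<omega> + tree_disp v (tree i \<omega>)\<bar> < a}" for v i
  define Bad where "Bad = (\<Union>v\<in>{v. length v = n}. \<Union>i. bad v i)"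
  have G: "{x. tree_gen n x = {}} \<in> sets tree_space" by (rule Collect_in_sets_tree_space) measurable
  have bad_sets [measurable]: "bad v i \<in> events" for v i unfolding bad_def by measurable
  have Bad_sets [measurable]: "Bad \<in> events" unfolding Bad_def by measurable
  have good_prob: "prob good = exp (- (1 - extinct_prob n) * (2 * c))"
    unfolding good_def extinct_prob_def using c by (subst prob_all_trees_in[OF _ _ _ G]) (auto simp: bounded_Ioo)
  have "emeasure M Bad \<le> (\<integral>\<^sup>+v. emeasure M (\<Union>i. bad v i) \<partial>count_space {v. length v = n})"
    unfolding Bad_def by (intro emeasure_UN_countable_le) auto
  also have "\<dots> \<le> (\<integral>\<^sup>+v. (\<Sum>i. emeasure M (bad v i)) \<partial>count_space {v. length v = n})"
    by (intro nn_integral_mono emeasure_subadditive_countably) auto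
  \<comment> \<open>For each label, the sum over all roots is evaluated by
    \<open>campbell_shifted_interval\<close> with shift \<open>tree_disp v\<close>.\<close>
  also have "\<dots> = (\<integral>\<^sup>+v. ennreal (2 * a) * emeasure tree_law {x. v \<in> tree_gen n x \<and> \<bar>tree_disp v x\<bar> > \<epsilon> * real n}
      \<partial>count_space {v. length v = n})"
    unfolding bad_def using a by (intro nn_integral_cong campbell_shifted_interval) measurable
  also have "\<dots> \<le> ennreal (2 * a) * ennreal (tail_bound \<epsilon> n)"
    by (subst nn_integral_cmult) (auto intro!: mult_left_mono sum_path_tail_le n)
  also have "\<dots> = ennreal (2 * a * tail_bound \<epsilon> n)" using a by (simp add: ennreal_mult tail_bound_nonneg)
  finally have bad_prob: "prob Bad \<le> 2 * a * tail_bound \<epsilon> n"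
    using a by (simp add: emeasure_eq_measure tail_bound_nonneg)
  have "good \<subseteq> empty_ball n a \<union> Bad"
  proof
    fix \<omega> assume \<omega>: "\<omega> \<in> good"
    show "\<omega> \<in> empty_ball n a \<union> Bad"
    proof (rule ccontr)
      assume neg: "\<omega> \<notin> empty_ball n a \<union> Bad"
      then obtain i v where v: "v \<in> tree_gen n (tree i \<omega>)" "\<bar>\<xi> i \<omega> + tree_disp v (tree i \<omega>)\<bar> < a"
        using \<omega> by (auto simp: empty_ball_def good_def not_le)
      then have "\<xi> i \<omega> \<notin> {-c<..<c}" using \<omega> by (auto simp: good_def)
      \<comment> \<open>The root is at distance at least \<open>c\<close> and the particle at
        distance less than \<open>a\<close>, and \<open>c - a\<close> is
        \<open>\<epsilon> n\<close>.\<close>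
      then have "\<bar>tree_disp v (tree i \<omega>)\<bar> > \<epsilon> * real n" using v(2) by (auto simp: c_def)
      then have "\<omega> \<in> bad v i" using v \<omega> by (simp add: bad_def good_def)
      moreover have "length v = n" using v(1) by (simp add: tree_gen_def)
      ultimately show False using neg by (auto simp: Bad_def)
    qed
  qed
  then have "prob good \<le> prob (empty_ball n a \<union> Bad)" by (intro finite_measure_mono) auto
  also have "\<dots> \<le> prob (empty_ball n a) + prob Bad" by (intro measure_Un_le) auto
  finally show ?thesis using good_prob bad_prob by (simp add: c_def)
qed

text \<open>If the ball is empty, a tree rooted within \<open>a - \<epsilon> n\<close> has no
  particle displaced by at most \<open>\<epsilon> n\<close>, hence is extinct or has a far particle.
  This is a property of single trees, so thinning applies directly and the error appears in the
  exponent.\<close>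

lemma prob_empty_ball_le:
  assumes n: "1 \<le> n" and a: "\<epsilon> * real n < a"
  shows "prob (empty_ball n a) \<le> exp (- (1 - extinct_prob n - tail_bound \<epsilon> n) * (2 * (a - \<epsilon> * real n)))"
proof -
  define c where "c = a - \<epsilon> * real n"
  have c: "0 < c" using a by (simp add: c_def)
  \<comment> \<open>Extinct trees belong to \<open>G\<close> vacuously.\<close>
  define G where "G = {x. \<forall>v. v \<in> tree_gen n x \<longrightarrow> \<bar>tree_disp v x\<bar> > \<epsilon> * real n}"
  define F where "F = {x. \<exists>v. v \<in> tree_gen n x \<and> \<bar>tree_disp v x\<bar> > \<epsilon> * real n}"
  have G: "G \<in> sets tree_space" unfolding G_def by (rule Collect_in_sets_tree_space) measurable
  have F: "F \<in> sets tree_space" unfolding F_def by (rule Collect_in_sets_tree_space) measurable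
  have E: "{x. tree_gen n x = {}} \<in> sets tree_space" by (rule Collect_in_sets_tree_space) measurable
  have "measure tree_law G \<le> measure tree_law ({x. tree_gen n x = {}} \<union> F)"
    using E F by (intro tree.finite_measure_mono) (auto simp: G_def F_def sets_tree_law)
  also have "\<dots> \<le> extinct_prob n + measure tree_law F"
    unfolding extinct_prob_def using E F by (intro measure_Un_le) (auto simp: sets_tree_law)
  also have "measure tree_law F \<le> tail_bound \<epsilon> n"
    using far_particle_prob_le[OF n, of \<epsilon>] by (simp add: F_def Bex_def)
  finally have G_le: "measure tree_law G \<le> extinct_prob n + tail_bound \<epsilon> n" by simp
  define good where "good = {\<omega> \<in> space M. \<forall>i. \<xi> i \<omega> \<in> {-c<..<c} \<longrightarrow> tree i \<omega> \<in> G}"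
  have [measurable]: "good \<in> events" unfolding good_def using G by measurable
  have "empty_ball n a \<subseteq> good"
  proof
    fix \<omega> assume \<omega>: "\<omega> \<in> empty_ball n a"
    have "\<bar>tree_disp v (tree i \<omega>)\<bar> > \<epsilon> * real n"
      if "\<xi> i \<omega> \<in> {-c<..<c}" "v \<in> tree_gen n (tree i \<omega>)" for i v
    proof -
      have "a \<le> \<bar>\<xi> i \<omega> + tree_disp v (tree i \<omega>)\<bar>" using \<omega> that by (auto simp: empty_ball_def)
      then show ?thesis using that(1) unfolding c_def greaterThanLessThan_iff by linarith
    qed
    then show "\<omega> \<in> good" using \<omega> by (auto simp: good_def G_def empty_ball_def)
  qed
  then have "prob (empty_ball n a) \<le> prob good" by (intro finite_measure_mono) auto
  also have "\<dots> = exp (- (1 - measure tree_law G) * (2 * c))"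
    unfolding good_def using c by (subst prob_all_trees_in[OF _ _ _ G]) (auto simp: bounded_Ioo)
  also have "\<dots> \<le> exp (- (1 - extinct_prob n - tail_bound \<epsilon> n) * (2 * c))"
    using G_le c by (auto intro!: mult_right_mono)
  finally show ?thesis by (simp add: c_def)
qed

text \<open>For fixed \<open>\<epsilon>\<close> both bounds converge, since
  \<open>n * tail_bound \<epsilon> n\<close> vanishes. The constant 4 is the factor 2 from the
  length of the interval times the 2 in Kolmogorov's estimate. Continuity at
  \<open>\<epsilon> = 0\<close> then closes the gap.\<close>

theorem tendsto_prob_empty_ball:
  assumes r: "0 < r"
  shows "(\<lambda>n. prob (empty_ball n (r * real n))) \<longlonglongrightarrow> exp (- 4 * r / offspring_var)"
proof -
  have lower: "(\<lambda>n. exp (- (1 - extinct_prob n) * (2 * (r * real n + \<epsilon> * real n))) - 2 * (r * real n) * tail_bound \<epsilon> n)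
      \<longlonglongrightarrow> exp (- 4 * (r + \<epsilon>) / offspring_var)" if "0 < \<epsilon>" for \<epsilon>
  proof -
    have "(\<lambda>n. exp (- 2 * (r + \<epsilon>) * (real n * (1 - extinct_prob n))) - 2 * r * (real n * tail_bound \<epsilon> n))
        \<longlonglongrightarrow> exp (- 2 * (r + \<epsilon>) * (2 / offspring_var)) - 2 * r * 0"
      by (intro tendsto_intros tendsto_survival_prob tendsto_tail_bound that)
    then show ?thesis by (simp add: algebra_simps)
  qed
  have upper: "(\<lambda>n. exp (- (1 - extinct_prob n - tail_bound \<epsilon> n) * (2 * (r * real n - \<epsilon> * real n))))
      \<longlonglongrightarrow> exp (- 4 * (r - \<epsilon>) / offspring_var)" if "0 < \<epsilon>" for \<epsilon>
  proof -
    have "(\<lambda>n. exp (- 2 * (r - \<epsilon>) * (real n * (1 - extinct_prob n) - real n * tail_bound \<epsilon> n)))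
        \<longlonglongrightarrow> exp (- 2 * (r - \<epsilon>) * (2 / offspring_var - 0))"
      by (intro tendsto_intros tendsto_survival_prob tendsto_tail_bound that)
    then show ?thesis by (simp add: algebra_simps)
  qed
  show ?thesis
  proof (rule order_tendstoI)
    fix l assume l: "l < exp (- 4 * r / offspring_var)"
    have "((\<lambda>\<epsilon>. exp (- 4 * (r + \<epsilon>) / offspring_var)) \<longlongrightarrow> exp (- 4 * (r + 0) / offspring_var)) (at_right 0)"
      unfolding divide_inverse by (intro tendsto_intros)
    then have "\<forall>\<^sub>F \<epsilon> in at_right 0. l < exp (- 4 * (r + \<epsilon>) / offspring_var) \<and> 0 < \<epsilon>"
      using l by (intro eventually_conj order_tendstoD(1) eventually_at_right_less) auto
    then obtain \<epsilon> where \<epsilon>: "l < exp (- 4 * (r + \<epsilon>) / offspring_var)" "0 < \<epsilon>"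
      by (auto dest!: eventually_happens'[OF trivial_limit_at_right_real])
    from order_tendstoD(1)[OF lower[OF \<epsilon>(2)] \<epsilon>(1)] eventually_ge_at_top[of 1]
    show "\<forall>\<^sub>F n in sequentially. l < prob (empty_ball n (r * real n))"
    proof eventually_elim
      case (elim n)
      then show ?case using prob_empty_ball_ge[of n "r * real n" \<epsilon>] r \<epsilon> by simp
    qed
  next
    fix l assume l: "exp (- 4 * r / offspring_var) < l"
    have "((\<lambda>\<epsilon>. exp (- 4 * (r - \<epsilon>) / offspring_var)) \<longlongrightarrow> exp (- 4 * (r - 0) / offspring_var)) (at_right 0)"
      unfolding divide_inverse by (intro tendsto_intros)
    \<comment> \<open>Besides being small, \<open>\<epsilon>\<close> must stay below
      \<open>r\<close>, so that the shrunken window has positive length.\<close>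
    then have "\<forall>\<^sub>F \<epsilon> in at_right 0. exp (- 4 * (r - \<epsilon>) / offspring_var) < l \<and> \<epsilon> \<in> {0<..<r}"
      using l r by (intro eventually_conj order_tendstoD(2) eventually_at_right_real) auto
    then obtain \<epsilon> where \<epsilon>: "exp (- 4 * (r - \<epsilon>) / offspring_var) < l" "0 < \<epsilon>" "\<epsilon> < r"
      by (auto dest!: eventually_happens'[OF trivial_limit_at_right_real])
    from order_tendstoD(2)[OF upper[OF \<epsilon>(2)] \<epsilon>(1)] eventually_ge_at_top[of 1]
    show "\<forall>\<^sub>F n in sequentially. prob (empty_ball n (r * real n)) < l"
    proof eventually_elim
      case (elim n)
      then show ?case using prob_empty_ball_le[of n \<epsilon> "r * real n"] \<epsilon> by simp
    qed
  qed
qed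

end

theorem theorem1p1:
  fixes M :: "'a measure" and p :: "nat pmf" and \<mu> :: "real measure" and \<alpha> r :: real
    and \<xi> :: "nat \<Rightarrow> 'a \<Rightarrow> real"
    and K :: "nat \<Rightarrow> nat list \<Rightarrow> 'a \<Rightarrow> nat" and D :: "nat \<Rightarrow> nat list \<Rightarrow> 'a \<Rightarrow> real"
  assumes M: "prob_space M"
    and p0: "pmf p 0 < 1" and p1: "pmf p 1 < 1"
    and mean_int: "integrable (measure_pmf p) real"
    and mean1: "measure_pmf.expectation p real = 1"
    and var_fin: "integrable (measure_pmf p) (\<lambda>k. (real k)\<^sup>2)"
    and \<mu>: "prob_space \<mu>" "sets \<mu> = sets borel"
    and X_int: "integrable \<mu> (\<lambda>x. x)" and X_mean: "(\<integral>x. x \<partial>\<mu>) = 0"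
    and \<alpha>: "\<alpha> > 2" and X_mom: "integrable \<mu> (\<lambda>x. \<bar>x\<bar> powr \<alpha>)"
    and Z0: "poisson_point_seq M \<xi>"
    and tree_indep: "prob_space.indep_vars M (\<lambda>_. count_space UNIV \<Otimes>\<^sub>M borel)
                        (\<lambda>(i, v) \<omega>. (K i v \<omega>, D i v \<omega>)) UNIV"
    and tree_law: "\<And>i v. distr M (count_space UNIV \<Otimes>\<^sub>M borel) (\<lambda>\<omega>. (K i v \<omega>, D i v \<omega>))
                        = measure_pmf p \<Otimes>\<^sub>M \<mu>"
    and Z0_tree_indep: "prob_space.indep_set M
        {(\<lambda>\<omega> i. \<xi> i \<omega>) -` S \<inter> space M | S. S \<in> sets (Pi\<^sub>M UNIV (\<lambda>_. borel))}
        {(\<lambda>\<omega> (iv :: nat \<times> nat list). (K (fst iv) (snd iv) \<omega>, D (fst iv) (snd iv) \<omega>)) -` S \<inter> space M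
           | S. S \<in> sets (Pi\<^sub>M UNIV (\<lambda>_. count_space UNIV \<Otimes>\<^sub>M borel))}"
    and r: "r > 0"
  shows "(\<lambda>n. measure M {\<omega> \<in> space M. brw_R \<xi> K D n \<omega> \<ge> ereal (r * real n)})
           \<longlonglongrightarrow> exp (- 4 * r / measure_pmf.variance p real)"
proof -
  have offspring: "critical_offspring p"
    by (rule critical_offspring.intro) fact+
  have displacement: "displacement \<mu> \<alpha>"
    by (rule displacement.intro) fact+
  interpret poisson_branching_walk p \<mu> \<alpha> M \<xi> K D
    by (intro poisson_branching_walk.intro branching_walk.intro offspring displacement M
        poisson_branching_walk_axioms.intro Z0 tree_indep tree_law Z0_tree_indep)
  \<comment> \<open>The equality is claimed only eventually because \<open>empty_ball_eq\<close>
    requires a positive radius, which excludes \<open>n = 0\<close>.\<close>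
  have "\<forall>\<^sub>F n in sequentially. prob (empty_ball n (r * real n))
      = measure M {\<omega> \<in> space M. brw_R \<xi> K D n \<omega> \<ge> ereal (r * real n)}"
    using eventually_ge_at_top[of 1] by eventually_elim (use r in \<open>simp add: empty_ball_eq\<close>)
  then show ?thesis
    using tendsto_prob_empty_ball[OF r] by (rule Lim_transform_eventually[rotated])
qed

end
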